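(* Consider the planar Stark problem $$\ddot x=-\frac{x}{r^3}+1,\qquad \ddot y=-\frac{y}{r^3},\qquad r=\sqrt{x^2+y^2}.$$ For any $a\in(0,1)$ there exist $k_p\in\mathbb N$ and real numbers $\{b_k\}_{k\ge k_p}$, $\{b'_k\}_{k\ge k_p}$ such that, letting $A_k$ and $B_k$ denote the solutions with initial position $(x(0),y(0))=(a,0)$ and initial velocities $(\dot x(0),\dot y(0))=(0,b_k)$ and $(0,b'_k)$ respectively, the following hold: (i) $A_k$ is a periodic orbit which (for $t>0$) intersects the positive $x$-axis $k$ times and then intersects the negative $x$-axis perpendicularly; (ii) $B_k$ is a collision orbit which (for $t>0$) intersects the positive $x$-axis $k$ times before collision with the origin; (iii) $\lim_{k\to+\infty}b_k=\lim_{k\to+\infty}b'_k=\sqrt{\tfrac{2}{a}-2a}$, and $\lim_{a\to1}k_p=+\infty$, where $k_p=k_p(a)$ is taken as small as possible; (iv) $b_k<b'_k$ and $b'_k<b_{k+1}$ for all $k\ge k_p$.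
   Context: The positive (resp. negative) $x$-axis is $\{(x,0):x>0\}$ (resp. $\{(x,0):x<0\}$). A collision orbit is a solution reaching the origin in finite time. *)

theory Defs
  imports "HOL-Analysis.Analysis"
begin

definition stark_sol ::
  "(real \<Rightarrow> real) \<Rightarrow> (real \<Rightarrow> real) \<Rightarrow> (real \<Rightarrow> real) \<Rightarrow> (real \<Rightarrow> real) \<Rightarrow> real set \<Rightarrow> bool" where
  "stark_sol x y u v I \<longleftrightarrow>
     (\<forall>t\<in>I. (x t, y t) \<noteq> (0, 0) \<and>
        (x has_real_derivative u t) (at t within I) \<and>
        (y has_real_derivative v t) (at t within I) \<and>
        (u has_real_derivative (- x t / (sqrt (x t ^ 2 + y t ^ 2)) ^ 3 + 1)) (at t within I) \<and>
        (v has_real_derivative (- y t / (sqrt (x t ^ 2 + y t ^ 2)) ^ 3)) (at t within I))"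

definition stark_init ::
  "(real \<Rightarrow> real) \<Rightarrow> (real \<Rightarrow> real) \<Rightarrow> (real \<Rightarrow> real) \<Rightarrow> (real \<Rightarrow> real) \<Rightarrow> real \<Rightarrow> real \<Rightarrow> bool" where
  "stark_init x y u v a b \<longleftrightarrow> x 0 = a \<and> y 0 = 0 \<and> u 0 = 0 \<and> v 0 = b"

definition periodic_A :: "real \<Rightarrow> real \<Rightarrow> nat \<Rightarrow> bool" where
  "periodic_A a b k \<longleftrightarrow>
    (\<exists>x y u v. stark_sol x y u v {0..} \<and> stark_init x y u v a b \<and>
      (\<exists>P>0. \<forall>t\<ge>0. x (t + P) = x t \<and> y (t + P) = y t) \<and>
      (\<exists>T>0. y T = 0 \<and> x T < 0 \<and> u T = 0 \<and>
         (\<forall>t\<in>{0<..<T}. \<not> (y t = 0 \<and> x t < 0)) \<and>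
         finite {t\<in>{0<..<T}. y t = 0 \<and> x t > 0} \<and>
         card {t\<in>{0<..<T}. y t = 0 \<and> x t > 0} = k))"

definition collision_B :: "real \<Rightarrow> real \<Rightarrow> nat \<Rightarrow> bool" where
  "collision_B a b k \<longleftrightarrow>
    (\<exists>x y u v T. T > 0 \<and> stark_sol x y u v {0..<T} \<and> stark_init x y u v a b \<and>
      ((\<lambda>t. (x t, y t)) \<longlongrightarrow> (0, 0)) (at_left T) \<and>
      finite {t\<in>{0<..<T}. y t = 0 \<and> x t > 0} \<and>
      card {t\<in>{0<..<T}. y t = 0 \<and> x t > 0} = k)"

definition admissible_kp :: "real \<Rightarrow> nat \<Rightarrow> bool" where
  "admissible_kp a kp \<longleftrightarrow>
    (\<exists>b b' :: nat \<Rightarrow> real.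
       (\<forall>k\<ge>kp. periodic_A a (b k) k) \<and>
       (\<forall>k\<ge>kp. collision_B a (b' k) k) \<and>
       (b \<longlonglongrightarrow> sqrt (2 / a - 2 * a)) \<and>
       (b' \<longlonglongrightarrow> sqrt (2 / a - 2 * a)) \<and>
       (\<forall>k\<ge>kp. b k < b' k \<and> b' k < b (Suc k)))"

end

theory Submission
  imports Defs
begin

text \<open>
  The Stark problem separates in the parabolic coordinates \<open>x = (\<xi>\<^sup>2 - \<eta>\<^sup>2) / 2\<close>, \<open>y = \<xi> \<eta>\<close> with the
  regularised time \<open>dt = (\<xi>\<^sup>2 + \<eta>\<^sup>2) ds\<close>: for initial data \<open>(a, 0)\<close>, \<open>(0, b)\<close> with
  \<open>b\<^sup>2 < 2 / a - 2 a\<close> both coordinates oscillate, \<open>\<xi>\<close> starting at a maximum and \<open>\<eta>\<close> at a zero.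
  The positive axis is hit when \<open>\<eta> = 0\<close>, the negative one when \<open>\<xi> = 0\<close>. Let \<open>R b\<close> be the quotient
  of the quarter periods of \<open>\<xi>\<close> and \<open>\<eta>\<close>. Then \<open>R b = 2 k + 1\<close> gives the periodic orbit \<open>A\<^sub>k\<close>
  and \<open>R b = 2 k + 2\<close> the collision orbit \<open>B\<^sub>k\<close>. As \<open>\<xi>\<close> tends to a hyperbolic equilibrium when
  \<open>b\<close> tends to the critical velocity, \<open>R\<close> tends to infinity there; choosing the last
  solution of each equation makes the velocities interlace without any monotonicity of \<open>R\<close>.
  Finally \<open>R\<close> is uniformly large for \<open>a\<close> near 1, uniqueness of solutions identifies an arbitrary
  periodic orbit with the one above, and for \<open>b\<^sup>2 \<ge> 2 / a - 2 a\<close> the separation constant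
  keeps \<open>r + x = \<xi>\<^sup>2\<close> from decreasing to 0.
\<close>

section \<open>Phase functions\<close>

lemma exists_antiderivative:
  fixes f :: "real \<Rightarrow> real"
  assumes "continuous_on UNIV f"
  obtains F where "\<And>x. (F has_real_derivative f x) (at x)" "F 0 = 0"
proof -
  have "\<exists>F. \<forall>x::real. -\<infinity> < ereal x \<longrightarrow> ereal x < \<infinity> \<longrightarrow> (F has_vector_derivative f x) (at x)"
    by (rule einterval_antiderivative)
      (use assms in \<open>auto simp: continuous_on_eq_continuous_at\<close>)
  then obtain F where F: "\<And>x. (F has_real_derivative f x) (at x)"
    by (auto simp: has_real_derivative_iff_has_vector_derivative)
  show thesis
    by (rule that[of "\<lambda>x. F x - F 0"]) (auto intro!: derivative_eq_intros F)
qed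

text \<open>This inverts both the phase integrals and the time change. The derivative of
  \<open>g\<close> is asserted at the points \<open>f s\<close> only, so the image of
  \<open>S\<close> never has to be described; openness of \<open>S\<close> makes it
  two-sided.\<close>

lemma inverse_of_increasing:
  fixes f f' :: "real \<Rightarrow> real"
  assumes S: "open S" "is_interval S"
    and d: "\<And>s. s \<in> S \<Longrightarrow> (f has_real_derivative f' s) (at s)"
    and pos: "\<And>s. s \<in> S \<Longrightarrow> f' s > 0"
  obtains g where "\<And>s. s \<in> S \<Longrightarrow> g (f s) = s"
    "\<And>s. s \<in> S \<Longrightarrow> (g has_real_derivative 1 / f' s) (at (f s))" "strict_mono_on S f"
proof -
  have mono: "strict_mono_on S f"
  proof (rule strict_mono_onI)
    fix r s assume rs: "r \<in> S" "s \<in> S" "r < s"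
    show "f r < f s"
      by (rule DERIV_pos_imp_increasing[OF rs(3)]) (use mem_is_interval_1_I[OF S(2) rs(1,2)] d pos in blast)
  qed
  define g where "g = the_inv_into S f"
  have g: "g (f s) = s" if "s \<in> S" for s
    unfolding g_def using strict_mono_on_imp_inj_on[OF mono] that by (rule the_inv_into_f_f)
  have "(g has_real_derivative 1 / f' s) (at (f s))" if s: "s \<in> S" for s
    unfolding has_field_derivative_def
  proof (rule has_derivative_inverse_on[OF S(1), where f' = "\<lambda>s. (*) (f' s)" and g' = "\<lambda>s. (*) (1 / f' s)"])
    show "(f has_derivative (*) (f' x)) (at x)" if "x \<in> S" for x
      using d[OF that] by (simp add: has_field_derivative_def)
    show "(*) (f' s) \<circ> (*) (1 / f' s) = id"
      using pos[OF s] by (auto simp: fun_eq_iff)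
  qed (use g s in auto)
  with g mono show thesis using that by blast
qed

text \<open>Separation of variables: \<open>\<Phi>\<close> is the inverse of the antiderivative
  \<open>F\<close> of \<open>1 / sqrt w\<close> with \<open>F 0 = 0\<close>. Evenness makes
  \<open>F\<close> odd; together with the period \<open>pi\<close> this makes every quarter turn
  \<open>pi / 2\<close> cost the same time \<open>L\<close>.\<close>

lemma phase_function:
  fixes w :: "real \<Rightarrow> real"
  assumes cont: "continuous_on UNIV w" and pos: "\<And>x. w x > 0"
    and even: "\<And>x. w (- x) = w x" and per: "\<And>x. w (x + pi) = w x"
    and L: "L = integral {0..pi / 2} (\<lambda>x. 1 / sqrt (w x))"
  obtains \<Phi> where "\<And>s. (\<Phi> has_real_derivative sqrt (w (\<Phi> s))) (at s)"
    "strict_mono \<Phi>" "\<And>i::int. \<Phi> (of_int i * L) = of_int i * (pi / 2)"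
    "\<And>s (n::nat). \<Phi> (s + of_nat n * (2 * L)) = \<Phi> s + of_nat n * pi" "L > 0"
proof -
  have "continuous_on UNIV (\<lambda>x. 1 / sqrt (w x))"
    using pos by (intro continuous_intros cont) (auto simp: less_imp_neq[symmetric])
  then obtain F where F: "\<And>x. (F has_real_derivative 1 / sqrt (w x)) (at x)" and F0: "F 0 = 0"
    using exists_antiderivative by blast
  have pos': "1 / sqrt (w x) > 0" for x using pos by simp
  obtain g where g: "\<And>s. g (F s) = s"
    and gd: "\<And>s. (g has_real_derivative 1 / (1 / sqrt (w s))) (at (F s))"
    and "strict_mono F"
    using inverse_of_increasing[of UNIV F "\<lambda>x. 1 / sqrt (w x)"] F pos' by auto
  have "((\<lambda>x. 1 / sqrt (w x)) has_integral F (pi/2) - F 0) {0..pi/2}"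
    by (rule fundamental_theorem_of_calculus)
      (auto simp: has_real_derivative_iff_has_vector_derivative[symmetric] intro!: has_field_derivative_at_within F)
  then have FL: "F (pi/2) = L" unfolding L F0 by (simp add: integral_unique)
  have Lpos: "L > 0" using strict_monoD[OF \<open>strict_mono F\<close>, of 0 "pi/2"] FL F0 by simp
  have odd: "F (- x) = - F x" for x
  proof -
    have "((\<lambda>x. F (- x) + F x) has_real_derivative 0) (at x)" for x
      by (rule derivative_eq_intros DERIV_chain2[OF F] F refl | simp add: even)+
    from DERIV_isconst_all[of "\<lambda>x. F (- x) + F x" x 0] this show ?thesis by (simp add: F0)
  qed
  have shift: "F (x + pi) = F x + 2 * L" for x
  proof -
    have "((\<lambda>x. F (x + pi) - F x) has_real_derivative 0) (at x)" for x
      by (rule derivative_eq_intros DERIV_chain2[OF F] F refl | simp add: per)+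
    \<comment> \<open>The constant is read off at \<open>-pi/2\<close>, where oddness gives
      \<open>F (pi/2) - F (-pi/2) = 2 * L\<close>.\<close>
    from DERIV_isconst_all[of "\<lambda>x. F (x + pi) - F x" x "-pi/2"] this show ?thesis
      using odd[of "pi/2"] by (simp add: FL)
  qed
  have shiftn: "F (x + of_nat n * pi) = F x + of_nat n * (2 * L)" for x n
  proof (induction n)
    case (Suc n)
    then show ?case using shift[of "x + of_nat n * pi"] by (simp add: algebra_simps)
  qed simp
  have Fnat: "F (of_nat n * (pi/2)) = of_nat n * L" for n
  proof (cases "even n")
    case True
    then obtain m where "n = 2 * m" by (auto elim: evenE)
    then show ?thesis using shiftn[of 0 m] by (simp add: F0 algebra_simps)
  next
    case False
    then obtain m where "n = 2 * m + 1" by (auto elim: oddE)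
    then show ?thesis using shiftn[of "pi/2" m] by (simp add: FL algebra_simps)
  qed
  have Fint: "F (of_int i * (pi/2)) = of_int i * L" for i
  proof (cases i rule: int_cases2)
    case (nonneg n)
    then show ?thesis using Fnat[of n] by simp
  next
    case (nonpos n)
    then show ?thesis using Fnat[of n] odd[of "of_nat n * (pi/2)"] by simp
  qed
  \<comment> \<open>\<open>F\<close> is unbounded in both directions because it gains
    \<open>L\<close> on each quarter turn, so the phase exists for all times.\<close>
  have surj: "\<exists>x. F x = s" for s
  proof -
    obtain n where n: "\<bar>s\<bar> < of_nat n * L" using ex_less_of_nat_mult[OF Lpos] by blast
    have "F (- (of_nat n * (pi/2))) \<le> s" "s \<le> F (of_nat n * (pi/2))"
      using n unfolding odd Fnat by auto
    moreover have "isCont F x" for x using F DERIV_isCont by blast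
    ultimately show ?thesis
      using IVT[of F "- (of_nat n * (pi/2))" s "of_nat n * (pi/2)"] by auto
  qed
  show thesis
  proof (rule that)
    show "(g has_real_derivative sqrt (w (g s))) (at s)" for s
      using surj[of s] g gd by force
    show "strict_mono g"
    proof (rule strict_monoI)
      fix r s :: real assume "r < s"
      then show "g r < g s"
        using surj[of r] surj[of s] g strict_mono_less[OF \<open>strict_mono F\<close>] by force
    qed
    show "g (of_int i * L) = of_int i * (pi/2)" for i using g Fint by metis
    show "g (s + of_nat n * (2 * L)) = g s + of_nat n * pi" for s n
      using surj[of s] g shiftn by metis
  qed fact
qed

section \<open>Levi-Civita transformation\<close>

text \<open>\<open>P\<close> and \<open>Q\<close> stand for the derivatives of \<open>X\<close> and
  \<open>Y\<close> in regularised time; each division by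
  \<open>(X t)\<^sup>2 + (Y t)\<^sup>2\<close>, which is twice the distance to the origin, passes to
  physical time. The separated equations alone are linear in the energy constant \<open>h\<close>;
  it is the energy relation that brings in the Kepler force.\<close>

lemma parabolic_stark_sol:
  fixes X Y P Q :: "real \<Rightarrow> real"
  assumes D: "\<And>t. t \<in> I \<Longrightarrow> (X has_real_derivative P t / ((X t)\<^sup>2 + (Y t)\<^sup>2)) (at t within I)"
      "\<And>t. t \<in> I \<Longrightarrow> (Y has_real_derivative Q t / ((X t)\<^sup>2 + (Y t)\<^sup>2)) (at t within I)"
      "\<And>t. t \<in> I \<Longrightarrow> (P has_real_derivative 2 * X t * (h + (X t)\<^sup>2) / ((X t)\<^sup>2 + (Y t)\<^sup>2)) (at t within I)"
      "\<And>t. t \<in> I \<Longrightarrow> (Q has_real_derivative 2 * Y t * (h - (Y t)\<^sup>2) / ((X t)\<^sup>2 + (Y t)\<^sup>2)) (at t within I)"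
    and energy: "\<And>t. t \<in> I \<Longrightarrow> (P t)\<^sup>2 + (Q t)\<^sup>2 = 4 + 2 * h * ((X t)\<^sup>2 + (Y t)\<^sup>2) + X t ^ 4 - Y t ^ 4"
    and pos: "\<And>t. t \<in> I \<Longrightarrow> (X t)\<^sup>2 + (Y t)\<^sup>2 > 0"
  shows "stark_sol (\<lambda>t. ((X t)\<^sup>2 - (Y t)\<^sup>2) / 2) (\<lambda>t. X t * Y t)
    (\<lambda>t. (X t * P t - Y t * Q t) / ((X t)\<^sup>2 + (Y t)\<^sup>2))
    (\<lambda>t. (P t * Y t + X t * Q t) / ((X t)\<^sup>2 + (Y t)\<^sup>2)) I"
  unfolding stark_sol_def
proof (intro ballI conjI)
  fix t assume t: "t \<in> I"
  define \<rho> where "\<rho> t = (X t)\<^sup>2 + (Y t)\<^sup>2" for t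
  note d = D[OF t, folded \<rho>_def]
  have \<rho>: "\<rho> t > 0" using pos[OF t] by (simp add: \<rho>_def)
  have E: "(P t)\<^sup>2 + (Q t)\<^sup>2 = 4 + 2 * h * \<rho> t + X t ^ 4 - Y t ^ 4"
    using energy[OF t] by (simp add: \<rho>_def)
  have r: "sqrt ((((X t)\<^sup>2 - (Y t)\<^sup>2) / 2)\<^sup>2 + (X t * Y t)\<^sup>2) = \<rho> t / 2"
    by (rule real_sqrt_unique) (use \<rho> in \<open>auto simp: \<rho>_def power2_eq_square field_simps\<close>)
  have d\<rho>: "(\<rho> has_real_derivative 2 * (X t * P t + Y t * Q t) / \<rho> t) (at t within I)"
  proof -
    have "((\<lambda>t. (X t)\<^sup>2 + (Y t)\<^sup>2) has_real_derivative 2 * (X t * P t + Y t * Q t) / \<rho> t) (at t within I)"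
      by (rule derivative_eq_intros d refl)+ (use \<rho> in \<open>simp, simp add: field_simps\<close>)
    then show ?thesis by (simp add: \<rho>_def[abs_def])
  qed
  \<comment> \<open>With denominators cleared, both acceleration equations become polynomial
    identities.\<close>
  have quot: "((\<lambda>t. f t / ((X t)\<^sup>2 + (Y t)\<^sup>2)) has_real_derivative c) (at t within I)"
    if "(f has_real_derivative N / \<rho> t) (at t within I)"
      and "N * \<rho> t - f t * (2 * (X t * P t + Y t * Q t)) = c * \<rho> t ^ 3" for f N c
  proof -
    have "((\<lambda>t. f t / \<rho> t) has_real_derivative
        (N / \<rho> t * \<rho> t - f t * (2 * (X t * P t + Y t * Q t) / \<rho> t)) / (\<rho> t * \<rho> t)) (at t within I)"
      using \<rho> by (intro DERIV_divide that(1) d\<rho>) auto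
    also have "(N / \<rho> t * \<rho> t - f t * (2 * (X t * P t + Y t * Q t) / \<rho> t)) / (\<rho> t * \<rho> t)
        = (N * \<rho> t - f t * (2 * (X t * P t + Y t * Q t))) / \<rho> t ^ 3"
      using \<rho> by (simp add: field_simps power3_eq_cube)
    also have "\<dots> = c" unfolding that(2) using \<rho> by simp
    finally show ?thesis unfolding \<rho>_def .
  qed
  show "(((X t)\<^sup>2 - (Y t)\<^sup>2) / 2, X t * Y t) \<noteq> (0, 0)"
    using pos[OF t] by auto
  show "((\<lambda>t. ((X t)\<^sup>2 - (Y t)\<^sup>2) / 2) has_real_derivative
      (X t * P t - Y t * Q t) / ((X t)\<^sup>2 + (Y t)\<^sup>2)) (at t within I)"
    unfolding \<rho>_def[symmetric]
    by (rule derivative_eq_intros d refl)+ (use \<rho> in \<open>simp, simp add: field_simps\<close>)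
  show "((\<lambda>t. X t * Y t) has_real_derivative
      (P t * Y t + X t * Q t) / ((X t)\<^sup>2 + (Y t)\<^sup>2)) (at t within I)"
    unfolding \<rho>_def[symmetric]
    by (rule derivative_eq_intros d refl)+ (use \<rho> in \<open>simp, simp add: field_simps\<close>)
  have dN: "((\<lambda>t. X t * P t - Y t * Q t) has_real_derivative
      ((P t)\<^sup>2 + X t * (2 * X t * (h + (X t)\<^sup>2)) - (Q t)\<^sup>2 - Y t * (2 * Y t * (h - (Y t)\<^sup>2))) / \<rho> t) (at t within I)"
    by (rule derivative_eq_intros d refl)+ (use \<rho> in \<open>simp add: field_simps power2_eq_square\<close>)
  have dM: "((\<lambda>t. P t * Y t + X t * Q t) has_real_derivative
      (2 * X t * (h + (X t)\<^sup>2) * Y t + 2 * P t * Q t + X t * (2 * Y t * (h - (Y t)\<^sup>2))) / \<rho> t) (at t within I)"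
    by (rule derivative_eq_intros d refl)+ (use \<rho> in \<open>simp add: field_simps power2_eq_square\<close>)
  \<comment> \<open>The rearrangement isolates \<open>(P t)\<^sup>2 + (Q t)\<^sup>2\<close>, so that
    the energy relation \<open>E\<close> can be substituted and \<open>h\<close> cancels.\<close>
  have "((P t)\<^sup>2 + X t * (2 * X t * (h + (X t)\<^sup>2)) - (Q t)\<^sup>2 - Y t * (2 * Y t * (h - (Y t)\<^sup>2))) * \<rho> t
      - (X t * P t - Y t * Q t) * (2 * (X t * P t + Y t * Q t))
    = - ((X t)\<^sup>2 - (Y t)\<^sup>2) * ((P t)\<^sup>2 + (Q t)\<^sup>2) + \<rho> t * (2 * h * ((X t)\<^sup>2 - (Y t)\<^sup>2) + 2 * (X t ^ 4 + Y t ^ 4))"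
    unfolding \<rho>_def by algebra
  also have "\<dots> = - 4 * ((X t)\<^sup>2 - (Y t)\<^sup>2) + \<rho> t ^ 3"
    unfolding E unfolding \<rho>_def by algebra
  also have "\<dots> = (- (((X t)\<^sup>2 - (Y t)\<^sup>2) / 2) / (\<rho> t / 2) ^ 3 + 1) * \<rho> t ^ 3"
    using \<rho> by (simp add: field_simps)
  finally show "((\<lambda>t. (X t * P t - Y t * Q t) / ((X t)\<^sup>2 + (Y t)\<^sup>2)) has_real_derivative
      - (((X t)\<^sup>2 - (Y t)\<^sup>2) / 2) / sqrt ((((X t)\<^sup>2 - (Y t)\<^sup>2) / 2)\<^sup>2 + (X t * Y t)\<^sup>2) ^ 3 + 1) (at t within I)"
    unfolding r by (rule quot[OF dN])
  have "(2 * X t * (h + (X t)\<^sup>2) * Y t + 2 * P t * Q t + X t * (2 * Y t * (h - (Y t)\<^sup>2))) * \<rho> t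
      - (P t * Y t + X t * Q t) * (2 * (X t * P t + Y t * Q t))
    = - 2 * X t * Y t * ((P t)\<^sup>2 + (Q t)\<^sup>2) + 2 * X t * Y t * \<rho> t * (2 * h + (X t)\<^sup>2 - (Y t)\<^sup>2)"
    unfolding \<rho>_def by algebra
  also have "\<dots> = - 8 * (X t * Y t)"
    unfolding E unfolding \<rho>_def by algebra
  also have "\<dots> = - (X t * Y t) / (\<rho> t / 2) ^ 3 * \<rho> t ^ 3"
    using \<rho> by (simp add: field_simps)
  finally show "((\<lambda>t. (P t * Y t + X t * Q t) / ((X t)\<^sup>2 + (Y t)\<^sup>2)) has_real_derivative
      - (X t * Y t) / sqrt ((((X t)\<^sup>2 - (Y t)\<^sup>2) / 2)\<^sup>2 + (X t * Y t)\<^sup>2) ^ 3) (at t within I)"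
    unfolding r by (rule quot[OF dM])
qed

section \<open>Uniqueness and first integrals\<close>

text \<open>By the mean value theorem \<open>f t * exp (- C * t)\<close> does not increase. Applied
  to a sum of squares that vanishes at 0, this forces the sum to stay 0.\<close>

lemma gronwall_zero:
  fixes f f' :: "real \<Rightarrow> real"
  assumes d: "\<And>t. t \<in> {0..c} \<Longrightarrow> (f has_real_derivative f' t) (at t within {0..c})"
    and le: "\<And>t. t \<in> {0..c} \<Longrightarrow> f' t \<le> C * f t"
    and "f 0 \<le> 0" "0 \<le> c"
  shows "f c \<le> 0"
proof (cases "c = 0")
  case False
  have "((\<lambda>t. f t * exp (- C * t)) has_derivative (*) ((f' t - C * f t) * exp (- C * t))) (at t within {0..c})"
    if "0 \<le> t" "t \<le> c" for t
    unfolding has_field_derivative_def[symmetric]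
    by (rule derivative_eq_intros d refl | use that in \<open>simp add: algebra_simps\<close>)+
  from mvt_simple[of 0 c, OF _ this] False \<open>0 \<le> c\<close> obtain t where
    "t \<in> {0<..<c}" "f c * exp (- C * c) - f 0 = (f' t - C * f t) * exp (- C * t) * c" by auto
  moreover then have "(f' t - C * f t) * exp (- C * t) * c \<le> 0"
    using le[of t] by (auto intro!: mult_nonpos_nonneg)
  ultimately have "f c * exp (- C * c) \<le> 0" using \<open>f 0 \<le> 0\<close> by simp
  then show ?thesis by (simp add: mult_le_0_iff)
qed (use assms in auto)

lemma stark_sol_subset: "stark_sol x y u v I \<Longrightarrow> J \<subseteq> I \<Longrightarrow> stark_sol x y u v J"
  unfolding stark_sol_def by (blast intro: DERIV_subset)

text \<open>The difference splits into \<open>(z - w) / r ^ 3\<close> and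
  \<open>(1 / r ^ 3 - 1 / s ^ 3) w\<close>. The first contributes one term and the second three,
  each at most \<open>cmod (z - w) / d ^ 3\<close>; hence the factor 4.\<close>

lemma kepler_force_lipschitz:
  fixes z w :: complex
  assumes "0 < d" "d \<le> cmod z" "d \<le> cmod w"
  shows "cmod ((1 / cmod z ^ 3) *\<^sub>R z - (1 / cmod w ^ 3) *\<^sub>R w) \<le> 4 / d ^ 3 * cmod (z - w)"
proof -
  define r s where rs: "r = cmod z" "s = cmod w"
  have pos: "r > 0" "s > 0" using assms by (auto simp: rs)
  have inv: "1 / (p * q * m) \<le> 1 / d ^ 3" if "p \<in> {r, s}" "q \<in> {r, s}" "m \<in> {r, s}" for p q m
  proof -
    have le: "d \<le> p" "d \<le> q" "d \<le> m" using that assms by (auto simp: rs)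
    have "d * d * d \<le> p * q * m" by (intro mult_mono mult_nonneg_nonneg) (use le assms in auto)
    then show ?thesis using assms by (intro divide_left_mono mult_pos_pos) (use le in \<open>auto simp: power3_eq_cube\<close>)
  qed
  have "(1 / r ^ 3) *\<^sub>R z - (1 / s ^ 3) *\<^sub>R w = (1 / r ^ 3) *\<^sub>R (z - w) + (1 / r ^ 3 - 1 / s ^ 3) *\<^sub>R w"
    by (simp add: algebra_simps)
  then have "cmod ((1 / r ^ 3) *\<^sub>R z - (1 / s ^ 3) *\<^sub>R w)
      \<le> 1 / r ^ 3 * cmod (z - w) + \<bar>1 / r ^ 3 - 1 / s ^ 3\<bar> * s"
    using norm_triangle_ineq[of "(1 / r ^ 3) *\<^sub>R (z - w)" "(1 / r ^ 3 - 1 / s ^ 3) *\<^sub>R w"] pos by (simp add: rs)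
  also have "\<bar>1 / r ^ 3 - 1 / s ^ 3\<bar> * s = \<bar>(1 / r ^ 3 - 1 / s ^ 3) * s\<bar>"
    using pos by (simp add: abs_mult)
  also have "(1 / r ^ 3 - 1 / s ^ 3) * s = (s - r) * (1 / (r * r * r) + 1 / (r * r * s) + 1 / (r * s * s))"
    using pos by (simp add: field_simps power3_eq_cube)
  also have "\<bar>\<dots>\<bar> = \<bar>s - r\<bar> * (1 / (r * r * r) + 1 / (r * r * s) + 1 / (r * s * s))"
    using pos by (simp add: abs_mult)
  also have "\<bar>s - r\<bar> * (1 / (r * r * r) + 1 / (r * r * s) + 1 / (r * s * s)) \<le> cmod (z - w) * (1 / d^3 + 1 / d^3 + 1 / d^3)"
    by (intro mult_mono add_mono inv) (use pos norm_triangle_ineq3[of z w] in \<open>auto simp: rs\<close>)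
  also have "1 / r ^ 3 * cmod (z - w) \<le> 1 / d ^ 3 * cmod (z - w)"
    using inv[of r r r] by (intro mult_right_mono) (auto simp: power3_eq_cube)
  finally show ?thesis by (simp add: rs)
qed

lemma stark_sol_continuous_on:
  assumes "stark_sol x y u v I"
  shows "continuous_on I x" "continuous_on I y"
  using assms unfolding stark_sol_def by (blast intro: DERIV_continuous_on)+

text \<open>Compactness of the time interval supplies the distance \<open>d\<close> that the
  Lipschitz bound for the force requires.\<close>

lemma stark_sol_away_from_origin:
  assumes s: "stark_sol x y u v {0..c}" and c: "0 \<le> c"
  obtains d where "d > 0" "\<And>t. t \<in> {0..c} \<Longrightarrow> d \<le> cmod (Complex (x t) (y t))"
proof -
  have "continuous_on {0..c} (\<lambda>t. cmod (Complex (x t) (y t)))"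
    by (intro continuous_intros stark_sol_continuous_on[OF s])
  from continuous_attains_inf[OF compact_Icc _ this] c obtain m where
    m: "m \<in> {0..c}" "\<And>t. t \<in> {0..c} \<Longrightarrow> cmod (Complex (x m) (y m)) \<le> cmod (Complex (x t) (y t))" by fastforce
  moreover have "cmod (Complex (x m) (y m)) > 0"
    using s m(1) by (auto simp: stark_sol_def complex_eq_iff)
  ultimately show thesis using that by blast
qed

text \<open>Gronwall for the squared distance in phase space. In the constant
  \<open>1 + 4 / d ^ 3\<close> the 1 comes from the coupling of position and velocity, the rest from
  the force.\<close>

lemma stark_sol_unique:
  assumes s1: "stark_sol x1 y1 u1 v1 {0..c}" and s2: "stark_sol x2 y2 u2 v2 {0..c}"
    and i1: "stark_init x1 y1 u1 v1 a b" and i2: "stark_init x2 y2 u2 v2 a b" and c: "0 \<le> c"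
  shows "x1 c = x2 c" "y1 c = y2 c"
proof -
  obtain d1 where d1: "d1 > 0" "\<And>t. t \<in> {0..c} \<Longrightarrow> d1 \<le> cmod (Complex (x1 t) (y1 t))"
    using stark_sol_away_from_origin[OF s1 c] by blast
  obtain d2 where d2: "d2 > 0" "\<And>t. t \<in> {0..c} \<Longrightarrow> d2 \<le> cmod (Complex (x2 t) (y2 t))"
    using stark_sol_away_from_origin[OF s2 c] by blast
  define d where "d = min d1 d2"
  define f where "f t = (x1 t - x2 t)\<^sup>2 + (y1 t - y2 t)\<^sup>2 + (u1 t - u2 t)\<^sup>2 + (v1 t - v2 t)\<^sup>2" for t
  define fx where "fx t = x1 t / (sqrt ((x1 t)\<^sup>2 + (y1 t)\<^sup>2)) ^ 3 - x2 t / (sqrt ((x2 t)\<^sup>2 + (y2 t)\<^sup>2)) ^ 3" for t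
  define fy where "fy t = y1 t / (sqrt ((x1 t)\<^sup>2 + (y1 t)\<^sup>2)) ^ 3 - y2 t / (sqrt ((x2 t)\<^sup>2 + (y2 t)\<^sup>2)) ^ 3" for t
  define f' where "f' t = 2 * ((x1 t - x2 t) * (u1 t - u2 t) + (y1 t - y2 t) * (v1 t - v2 t)
    - (u1 t - u2 t) * fx t - (v1 t - v2 t) * fy t)" for t
  have "f c \<le> 0"
  proof (rule gronwall_zero[where f = f and f' = f' and C = "1 + 4 / d ^ 3"])
    fix t assume t: "t \<in> {0..c}"
    have D: "(x1 has_real_derivative u1 t) (at t within {0..c})" "(x2 has_real_derivative u2 t) (at t within {0..c})"
      "(y1 has_real_derivative v1 t) (at t within {0..c})" "(y2 has_real_derivative v2 t) (at t within {0..c})"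
      "(u1 has_real_derivative (- x1 t / (sqrt ((x1 t)\<^sup>2 + (y1 t)\<^sup>2)) ^ 3 + 1)) (at t within {0..c})"
      "(u2 has_real_derivative (- x2 t / (sqrt ((x2 t)\<^sup>2 + (y2 t)\<^sup>2)) ^ 3 + 1)) (at t within {0..c})"
      "(v1 has_real_derivative (- y1 t / (sqrt ((x1 t)\<^sup>2 + (y1 t)\<^sup>2)) ^ 3)) (at t within {0..c})"
      "(v2 has_real_derivative (- y2 t / (sqrt ((x2 t)\<^sup>2 + (y2 t)\<^sup>2)) ^ 3)) (at t within {0..c})"
      using s1 s2 t by (auto simp: stark_sol_def)
    have du: "((\<lambda>t. u1 t - u2 t) has_real_derivative - fx t) (at t within {0..c})"
      "((\<lambda>t. v1 t - v2 t) has_real_derivative - fy t) (at t within {0..c})"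
      using DERIV_diff[OF D(5,6)] DERIV_diff[OF D(7,8)] by (simp_all add: fx_def fy_def)
    have sq: "((\<lambda>t. (g t)\<^sup>2) has_real_derivative 2 * g t * g') (at t within {0..c})"
      if "(g has_real_derivative g') (at t within {0..c})" for g g'
      using DERIV_power[OF that, of 2] by (simp add: mult_ac)
    show "(f has_real_derivative f' t) (at t within {0..c})"
      unfolding f_def
      by (rule DERIV_cong[OF DERIV_add[OF DERIV_add[OF DERIV_add[OF sq[OF DERIV_diff[OF D(1,2)]]
            sq[OF DERIV_diff[OF D(3,4)]]] sq[OF du(1)]] sq[OF du(2)]]])
        (simp add: f'_def algebra_simps)
    define dz dw where "dz = Complex (x1 t - x2 t) (y1 t - y2 t)" and "dw = Complex (u1 t - u2 t) (v1 t - v2 t)"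
    define F where "F = Complex (fx t) (fy t)"
    have F: "F = (1 / cmod (Complex (x1 t) (y1 t)) ^ 3) *\<^sub>R Complex (x1 t) (y1 t)
       - (1 / cmod (Complex (x2 t) (y2 t)) ^ 3) *\<^sub>R Complex (x2 t) (y2 t)"
      unfolding F_def fx_def fy_def complex_eq_iff by (simp add: complex_norm)
    have "dz = Complex (x1 t) (y1 t) - Complex (x2 t) (y2 t)" by (simp add: dz_def complex_eq_iff)
    then have Fle: "cmod F \<le> 4 / d ^ 3 * cmod dz"
      unfolding F using kepler_force_lipschitz[of d] d1 d2 t by (force simp: d_def min_def)
    have "f' t = 2 * (dz \<bullet> dw) - 2 * (dw \<bullet> F)"
      by (simp add: f'_def dz_def dw_def F_def inner_complex_def algebra_simps)
    also have "\<dots> \<le> 2 * (cmod dz * cmod dw) + 2 * (cmod dw * cmod F)"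
      using Cauchy_Schwarz_ineq2[of dz dw] Cauchy_Schwarz_ineq2[of dw F] by linarith
    also have "\<dots> \<le> 2 * (cmod dz * cmod dw) + 2 * (cmod dw * (4 / d ^ 3 * cmod dz))"
      using Fle by (intro add_left_mono mult_left_mono) auto
    also have "\<dots> = (1 + 4 / d ^ 3) * (2 * cmod dz * cmod dw)" by (simp add: algebra_simps)
    also have "\<dots> \<le> (1 + 4 / d ^ 3) * ((cmod dz)\<^sup>2 + (cmod dw)\<^sup>2)"
      using sum_squares_bound[of "cmod dz" "cmod dw"] d1 d2 by (intro mult_left_mono) (auto simp: d_def)
    also have "(cmod dz)\<^sup>2 + (cmod dw)\<^sup>2 = f t"
      by (simp add: dz_def dw_def f_def cmod_power2)
    finally show "f' t \<le> (1 + 4 / d ^ 3) * f t" .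
  qed (use i1 i2 c in \<open>auto simp: f_def stark_init_def\<close>)
  then have "f c = 0" unfolding f_def by (smt (verit) zero_le_power2)
  then show "x1 c = x2 c" "y1 c = y2 c"
    unfolding f_def by (smt (verit) zero_le_power2 power2_eq_iff_nonneg zero_eq_power2)+
qed

text \<open>The first integral is twice the energy; the second is the \<open>x\<close>-component of
  the Runge-Lenz vector, corrected by \<open>(y t)\<^sup>2 / 2\<close> for the constant field. The
  derivative of \<open>r + x\<close> is recorded because this quantity is
  \<open>\<xi>\<^sup>2\<close>.\<close>

lemma stark_first_integrals:
  assumes s: "stark_sol x y u v {0..}" and i: "stark_init x y u v a b" and a: "0 < a" and t: "0 \<le> t"
  defines "r \<equiv> \<lambda>t. sqrt ((x t)\<^sup>2 + (y t)\<^sup>2)"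
  shows "(u t)\<^sup>2 + (v t)\<^sup>2 - 2 / r t - 2 * x t = b\<^sup>2 - 2 / a - 2 * a"
    "v t * (x t * v t - y t * u t) - x t / r t + (y t)\<^sup>2 / 2 = a * b\<^sup>2 - 1"
    "((\<lambda>t. r t + x t) has_real_derivative (x t * u t + y t * v t + r t * u t) / r t) (at t within {0..})"
    "r t > 0"
proof -
  have rpos: "r t > 0" if "t \<ge> 0" for t
    using s that by (auto simp: r_def stark_sol_def sum_power2_gt_zero_iff)
  have r2: "(r t)\<^sup>2 = (x t)\<^sup>2 + (y t)\<^sup>2" for t by (simp add: r_def)
  have D: "(x has_real_derivative u t) (at t within {0..})"
      "(y has_real_derivative v t) (at t within {0..})"
      "(u has_real_derivative (- x t / r t ^ 3 + 1)) (at t within {0..})"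
      "(v has_real_derivative (- y t / r t ^ 3)) (at t within {0..})" if "t \<ge> 0" for t
    using s that by (auto simp: stark_sol_def r_def)
  have Dr: "(r has_real_derivative (x t * u t + y t * v t) / r t) (at t within {0..})" if "t \<ge> 0" for t
    using rpos[OF that] unfolding r_def
    by (auto intro!: derivative_eq_intros D that simp: field_simps) (simp add: add_divide_distrib)
  show "((\<lambda>t. r t + x t) has_real_derivative (x t * u t + y t * v t + r t * u t) / r t) (at t within {0..})"
    using rpos[OF t] by (auto intro!: derivative_eq_intros D Dr t simp: field_simps)
  show "r t > 0" by (rule rpos[OF t])
  have "((\<lambda>t. (u t)\<^sup>2 + (v t)\<^sup>2 - 2 / r t - 2 * x t) has_real_derivative 0) (at t within {0..})" if "t \<in> {0..}" for t
    using rpos[of t] that by (auto intro!: derivative_eq_intros D Dr simp: field_simps power3_eq_cube)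
  from has_field_derivative_zero_constant[OF _ this] obtain c where
    "\<forall>t\<in>{0..}. (u t)\<^sup>2 + (v t)\<^sup>2 - 2 / r t - 2 * x t = c" by auto
  from this[rule_format, of t] this[rule_format, of 0] i a t
  show "(u t)\<^sup>2 + (v t)\<^sup>2 - 2 / r t - 2 * x t = b\<^sup>2 - 2 / a - 2 * a"
    by (simp add: stark_init_def r_def)
  have "((\<lambda>t. v t * (x t * v t - y t * u t) - x t / r t + (y t)\<^sup>2 / 2) has_real_derivative 0) (at t within {0..})"
    if "t \<in> {0..}" for t
  proof -
    have r: "r t > 0" using that rpos by auto
    define L where "L t = x t * v t - y t * u t" for t
    have dL: "(L has_real_derivative - y t) (at t within {0..})"
      unfolding L_def using that r by (auto intro!: derivative_eq_intros D simp: field_simps)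
    \<comment> \<open>The Kepler terms cancel among themselves; the torque \<open>- y t\<close>
      leaves \<open>- y t * v t\<close>, which the correction term removes.\<close>
    have "- y t / r t ^ 3 * (x t * v t - y t * u t) + v t * (- y t)
      - (u t * r t - x t * ((x t * u t + y t * v t) / r t)) / (r t)\<^sup>2 + y t * v t
      = (- y t * (x t * v t - y t * u t) - (u t * (r t)\<^sup>2 - x t * (x t * u t + y t * v t))) / r t ^ 3"
      using r by (simp add: field_simps power3_eq_cube power2_eq_square)
    also have "\<dots> = 0" unfolding r2 by (simp add: algebra_simps power2_eq_square)
    finally have zero: "- y t / r t ^ 3 * (x t * v t - y t * u t) + v t * (- y t)
      - (u t * r t - x t * ((x t * u t + y t * v t) / r t)) / (r t)\<^sup>2 + y t * v t = 0" .
    have t: "0 \<le> t" using that by simp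
    have dy2: "((\<lambda>t. (y t)\<^sup>2 / 2) has_real_derivative y t * v t) (at t within {0..})"
      by (auto intro!: derivative_eq_intros D(2) t)
    have "((\<lambda>t. v t * L t - x t / r t + (y t)\<^sup>2 / 2) has_real_derivative
       - y t / r t ^ 3 * L t + v t * (- y t)
      - (u t * r t - x t * ((x t * u t + y t * v t) / r t)) / (r t)\<^sup>2 + y t * v t) (at t within {0..})"
      by (rule DERIV_cong[OF DERIV_add[OF DERIV_diff[OF DERIV_mult[OF D(4)[OF t] dL]
            DERIV_divide[OF D(1)[OF t] Dr[OF t]]] dy2]])
        (use r in \<open>simp_all add: power2_eq_square\<close>)
    then show ?thesis unfolding L_def zero .
  qed
  from has_field_derivative_zero_constant[OF _ this] obtain c where
    "\<forall>t\<in>{0..}. v t * (x t * v t - y t * u t) - x t / r t + (y t)\<^sup>2 / 2 = c" by auto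
  from this[rule_format, of t] this[rule_format, of 0] i a t
  show "v t * (x t * v t - y t * u t) - x t / r t + (y t)\<^sup>2 / 2 = a * b\<^sup>2 - 1"
    by (simp add: stark_init_def r_def algebra_simps power2_eq_square)
qed

text \<open>For \<open>p = r + x = \<xi>\<^sup>2\<close> the two integrals give \<open>(r p')\<^sup>2 = p (2 a - p) (D - p)\<close> with \<open>D \<le> 2 a\<close> and
  \<open>p 0 = 2 a\<close>: if \<open>D < 2 a\<close>, then \<open>p\<close> cannot enter the interval between \<open>D\<close> and \<open>2 a\<close>, and if
  \<open>D = 2 a\<close>, then \<open>p\<close> is constant.\<close>

lemma stark_barrier:
  assumes s: "stark_sol x y u v {0..}" and i: "stark_init x y u v a b" and a: "0 < a"
    and b: "b\<^sup>2 \<ge> 2 / a - 2 * a" and T: "0 \<le> T" "y T = 0"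
  shows "x T \<ge> 0"
proof -
  define r where "r t = sqrt ((x t)\<^sup>2 + (y t)\<^sup>2)" for t
  define p where "p t = r t + x t" for t
  define w where "w t = x t * u t + y t * v t + r t * u t" for t
  define D where "D = 2 / a - b\<^sup>2"
  have D: "D \<le> 2 * a" using b by (simp add: D_def)
  note fi = stark_first_integrals[OF s i a, folded r_def, folded p_def w_def]
  have p0: "p 0 = 2 * a" using i a by (simp add: p_def r_def stark_init_def)
  \<comment> \<open>Here \<open>w\<close> is \<open>r\<close> times the derivative of
    \<open>p\<close>, and the two first integrals eliminate the velocities.\<close>
  have w: "(w t)\<^sup>2 = p t * (2 * a - p t) * (D - p t)" if t: "0 \<le> t" for t
  proof -
    note E = fi(1)[OF t] and K = fi(2)[OF t] and r = fi(4)[OF t]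
    have r2: "(r t)\<^sup>2 = (x t)\<^sup>2 + (y t)\<^sup>2" by (simp add: r_def)
    define ir where "ir = 1 / r t"
    have ir: "ir * r t = 1" using r by (simp add: ir_def)
    have E': "(u t)\<^sup>2 + (v t)\<^sup>2 - 2 * ir - 2 * x t = - 2 * a - D"
      using E by (simp add: ir_def D_def)
    have aD: "a * D = 2 - a * b\<^sup>2" using a by (simp add: D_def right_diff_distrib)
    have K': "v t * (x t * v t - y t * u t) - x t * ir + (y t)\<^sup>2 / 2 = 1 - a * D"
      using K aD by (simp add: ir_def)
    have "(w t)\<^sup>2 = p t * (p t * (u t)\<^sup>2 + 2 * y t * u t * v t + (r t - x t) * (v t)\<^sup>2)"
      unfolding w_def p_def using r2 by algebra
    also have "p t * (u t)\<^sup>2 + 2 * y t * u t * v t + (r t - x t) * (v t)\<^sup>2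
      = 2 - 2 * (v t * (x t * v t - y t * u t) - x t * ir + (y t)\<^sup>2 / 2)
        + ((u t)\<^sup>2 + (v t)\<^sup>2 - 2 * ir - 2 * x t) * p t + (p t)\<^sup>2"
      unfolding p_def using r2 ir by algebra
    also have "\<dots> = (2 * a - p t) * (D - p t)" unfolding E' K' by (simp add: algebra_simps power2_eq_square)
    finally show ?thesis by (simp add: mult.assoc)
  qed
  have cont: "continuous_on {0..T} r" "continuous_on {0..T} p"
    unfolding p_def r_def using stark_sol_continuous_on[OF s]
    by (auto intro!: continuous_intros intro: continuous_on_subset)
  have "p T > 0"
  proof (cases "D = 2 * a")
    case False
    have "p T \<ge> 2 * a"
    proof (rule ccontr)
      assume less: "\<not> p T \<ge> 2 * a"
      \<comment> \<open>A level strictly below \<open>2 * a\<close> and above \<open>D\<close> and 0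
        that \<open>p\<close> would have to pass on its way down to \<open>p T\<close>; there the
        square \<open>w\<^sup>2\<close> would be negative.\<close>
      define m where "m = (max (max D (p T)) 0 + 2 * a) / 2"
      have m: "D < m" "p T \<le> m" "0 < m" "m < 2 * a" using less False D a by (auto simp: m_def)
      from IVT2'[OF _ _ T(1) cont(2), of m] p0 m obtain t where "0 \<le> t" "p t = m" by auto
      with w[of t] have "0 \<le> m * (2 * a - m) * (D - m)" by (metis zero_le_power2)
      moreover have "m * (2 * a - m) * (D - m) < 0" using m by (intro mult_pos_neg mult_pos_pos) auto
      ultimately show False by simp
    qed
    then show ?thesis using a by simp
  next
    case True
    \<comment> \<open>In the double root case the derivative of \<open>p\<close> has absolute value
      \<open>sqrt (p t) / r t * \<bar>p t - 2 * a\<bar>\<close>, so a bound on the coefficient lets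
      Gronwall keep \<open>p\<close> at \<open>2 * a\<close>.\<close>
    have "continuous_on {0..T} (\<lambda>t. sqrt (p t) / r t)"
      by (intro continuous_intros cont) (use fi(4) in force)
    from continuous_attains_sup[OF compact_Icc _ this] T obtain m where
      m: "\<And>t. t \<in> {0..T} \<Longrightarrow> sqrt (p t) / r t \<le> m" by fastforce
    have "(p T - 2 * a)\<^sup>2 \<le> 0"
    proof (rule gronwall_zero[where f = "\<lambda>t. (p t - 2 * a)\<^sup>2"])
      fix t assume t: "t \<in> {0..T}"
      have "(p has_real_derivative w t / r t) (at t within {0..T})"
        using fi(3)[of t] t by (auto intro: DERIV_subset)
      then show "((\<lambda>t. (p t - 2 * a)\<^sup>2) has_real_derivative 2 * ((p t - 2 * a) * (w t / r t))) (at t within {0..T})"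
        by (auto intro!: derivative_eq_intros)
      have "(w t)\<^sup>2 = p t * (p t - 2 * a)\<^sup>2" using w[of t] t True by (simp add: algebra_simps power2_eq_square)
      then have "\<bar>w t\<bar> = sqrt (p t) * \<bar>p t - 2 * a\<bar>" by (metis real_sqrt_abs real_sqrt_mult)
      then have "\<bar>(p t - 2 * a) * (w t / r t)\<bar> = sqrt (p t) / r t * (\<bar>p t - 2 * a\<bar> * \<bar>p t - 2 * a\<bar>)"
        using fi(4)[of t] t by (simp add: abs_mult del: abs_mult_self_eq)
      then have "(p t - 2 * a) * (w t / r t) \<le> sqrt (p t) / r t * (p t - 2 * a)\<^sup>2"
        unfolding abs_mult_self_eq power2_eq_square by linarith
      also have "\<dots> \<le> m * (p t - 2 * a)\<^sup>2"
        by (intro mult_right_mono m t) auto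
      finally show "2 * ((p t - 2 * a) * (w t / r t)) \<le> (2 * m) * (p t - 2 * a)\<^sup>2"
        unfolding mult.assoc by (rule mult_left_mono) simp
    qed (use p0 T in auto)
    then show ?thesis using a by simp
  qed
  then show ?thesis using T by (auto simp: p_def r_def)
qed

section \<open>Parabolic coordinates\<close>

text \<open>The orbit is \<open>\<xi> = sqrt (2 a) cos \<phi>\<close>, \<open>\<eta> = \<beta> sin \<psi>\<close> with \<open>\<beta>\<^sup>2 = eta_amp2\<close>; in these angles the
  separated energy equations lose their turning points and read \<open>\<phi>'\<^sup>2 = xi_rate\<close>,
  \<open>\<psi>'\<^sup>2 = eta_rate\<close>.\<close>

definition stark_energy :: "real \<Rightarrow> real \<Rightarrow> real" where
  "stark_energy a b = b\<^sup>2 / 2 - 1 / a - a"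

definition eta_amp2 :: "real \<Rightarrow> real \<Rightarrow> real" where
  "eta_amp2 a b = stark_energy a b + sqrt ((stark_energy a b)\<^sup>2 + 2 * a * b\<^sup>2)"

definition xi_rate :: "real \<Rightarrow> real \<Rightarrow> real \<Rightarrow> real" where
  "xi_rate a b \<phi> = 2 / a - 2 * a - b\<^sup>2 + 2 * a * (sin \<phi>)\<^sup>2"

definition eta_rate :: "real \<Rightarrow> real \<Rightarrow> real \<Rightarrow> real" where
  "eta_rate a b \<psi> = eta_amp2 a b * (1 + (sin \<psi>)\<^sup>2) - 2 * stark_energy a b"

definition xi_quarter :: "real \<Rightarrow> real \<Rightarrow> real" where
  "xi_quarter a b = integral {0..pi / 2} (\<lambda>\<phi>. 1 / sqrt (xi_rate a b \<phi>))"

definition eta_quarter :: "real \<Rightarrow> real \<Rightarrow> real" where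
  "eta_quarter a b = integral {0..pi / 2} (\<lambda>\<psi>. 1 / sqrt (eta_rate a b \<psi>))"

lemma xi_rate_pos: "0 < a \<Longrightarrow> b\<^sup>2 < 2 / a - 2 * a \<Longrightarrow> xi_rate a b \<phi> > 0"
  unfolding xi_rate_def by (smt (verit) mult_nonneg_nonneg zero_le_power2)

lemma eta_amp2_nonneg: "0 < a \<Longrightarrow> eta_amp2 a b \<ge> 0"
proof -
  assume "0 < a"
  then have "sqrt ((stark_energy a b)\<^sup>2) \<le> sqrt ((stark_energy a b)\<^sup>2 + 2 * a * b\<^sup>2)"
    by (intro real_sqrt_le_mono) simp
  then show ?thesis unfolding eta_amp2_def by simp
qed

lemma stark_energy_less:
  assumes "b\<^sup>2 < 2 / a - 2 * a"
  shows "stark_energy a b < - 2 * a"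
  using assms by (simp add: stark_energy_def)

lemma eta_rate_ge:
  assumes "0 < a" "b\<^sup>2 < 2 / a - 2 * a"
  shows "eta_rate a b \<psi> \<ge> 4 * a"
proof -
  have "eta_amp2 a b * (1 + (sin \<psi>)\<^sup>2) \<ge> 0" using eta_amp2_nonneg[OF assms(1)] by simp
  then show ?thesis using stark_energy_less[OF assms(2)] by (simp add: eta_rate_def)
qed

text \<open>The separated energy of \<eta> is \<open>\<eta>'\<^sup>2 = 2 * h * \<eta>\<^sup>2 -
  \<eta> ^ 4 + 2 * a * b\<^sup>2\<close>; the equation says that its right side vanishes at
  \<open>\<eta>\<^sup>2 = eta_amp2 a b\<close>.\<close>

lemma eta_amp2_root:
  assumes "0 < a"
  shows "eta_amp2 a b * (eta_amp2 a b - 2 * stark_energy a b) = 2 * a * b\<^sup>2"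
proof -
  have "(sqrt ((stark_energy a b)\<^sup>2 + 2 * a * b\<^sup>2))\<^sup>2 = (stark_energy a b)\<^sup>2 + 2 * a * b\<^sup>2"
    using assms by simp
  then show ?thesis unfolding eta_amp2_def by algebra
qed

text \<open>Collects what later arguments need from the construction, so that the angles can be
  forgotten. \<xi> vanishes at odd multiples of \<open>L1\<close>, \<eta> at even multiples of
  \<open>L2\<close>. The converse for \<eta> requires \<open>b \<noteq> 0\<close>, since for
  \<open>b = 0\<close> the orbit stays on the axis.\<close>

locale parabolic_orbit =
  fixes a b :: real and \<xi> \<eta> \<xi>' \<eta>' \<tau> :: "real \<Rightarrow> real" and h L1 L2 :: real
  defines "h \<equiv> stark_energy a b" and "L1 \<equiv> xi_quarter a b" and "L2 \<equiv> eta_quarter a b"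
  assumes a_pos: "0 < a"
    and D\<xi>: "\<And>s. (\<xi> has_real_derivative \<xi>' s) (at s)"
    and D\<eta>: "\<And>s. (\<eta> has_real_derivative \<eta>' s) (at s)"
    and D\<xi>': "\<And>s. (\<xi>' has_real_derivative 2 * \<xi> s * (h + (\<xi> s)\<^sup>2)) (at s)"
    and D\<eta>': "\<And>s. (\<eta>' has_real_derivative 2 * \<eta> s * (h - (\<eta> s)\<^sup>2)) (at s)"
    and energy: "\<And>s. (\<xi>' s)\<^sup>2 + (\<eta>' s)\<^sup>2 = 4 + 2 * h * ((\<xi> s)\<^sup>2 + (\<eta> s)\<^sup>2) + \<xi> s ^ 4 - \<eta> s ^ 4"
    and D\<tau>: "\<And>s. (\<tau> has_real_derivative (\<xi> s)\<^sup>2 + (\<eta> s)\<^sup>2) (at s)" and \<tau>_0: "\<tau> 0 = 0"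
    and init: "\<xi> 0 = sqrt (2 * a)" "\<eta> 0 = 0" "\<xi>' 0 = 0" "\<eta>' 0 = b * sqrt (2 * a)"
    and \<xi>_pos: "\<And>s. \<bar>s\<bar> < L1 \<Longrightarrow> \<xi> s > 0"
    and \<xi>_zero: "\<And>s. \<xi> s = 0 \<longleftrightarrow> (\<exists>i::int. odd i \<and> s = of_int i * L1)"
    and \<eta>_zero: "\<And>j::int. \<eta> (2 * of_int j * L2) = 0"
    and \<eta>_zeroD: "\<And>s. b \<noteq> 0 \<Longrightarrow> \<eta> s = 0 \<Longrightarrow> \<exists>j::int. s = 2 * of_int j * L2"
    and \<eta>'_zero: "\<And>j::int. \<eta>' ((2 * of_int j + 1) * L2) = 0"
    and \<xi>_periodic: "\<And>s. \<xi> (s + 4 * L1) = \<xi> s"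
    and \<eta>_periodic: "\<And>s (n::nat). \<eta> (s + of_nat n * (4 * L2)) = \<eta> s"
    and L_pos: "L1 > 0" "L2 > 0"

lemma parabolic_orbit_exists:
  assumes a: "0 < a" and b: "b\<^sup>2 < 2 / a - 2 * a"
  obtains \<xi> \<eta> \<xi>' \<eta>' \<tau> where "parabolic_orbit a b \<xi> \<eta> \<xi>' \<eta>' \<tau>"
proof -
  define h L1 L2 where h_def: "h = stark_energy a b" and L1_def: "L1 = xi_quarter a b" and L2_def: "L2 = eta_quarter a b"
  obtain \<Phi> where \<Phi>: "\<And>s. (\<Phi> has_real_derivative sqrt (xi_rate a b (\<Phi> s))) (at s)"
    "strict_mono \<Phi>" "\<And>i::int. \<Phi> (of_int i * L1) = of_int i * (pi / 2)"
    "\<And>s (n::nat). \<Phi> (s + of_nat n * (2 * L1)) = \<Phi> s + of_nat n * pi" "L1 > 0"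
  proof (rule phase_function)
    show "continuous_on UNIV (xi_rate a b)" unfolding xi_rate_def by (intro continuous_intros)
    show "xi_rate a b x > 0" for x by (rule xi_rate_pos[OF a b])
  qed (auto simp: xi_rate_def L1_def xi_quarter_def)
  have erp: "eta_rate a b x > 0" for x using eta_rate_ge[OF a b, of x] a by linarith
  obtain \<Psi> where \<Psi>: "\<And>s. (\<Psi> has_real_derivative sqrt (eta_rate a b (\<Psi> s))) (at s)"
    "strict_mono \<Psi>" "\<And>i::int. \<Psi> (of_int i * L2) = of_int i * (pi / 2)"
    "\<And>s (n::nat). \<Psi> (s + of_nat n * (2 * L2)) = \<Psi> s + of_nat n * pi" "L2 > 0"
  proof (rule phase_function)
    show "continuous_on UNIV (eta_rate a b)" unfolding eta_rate_def by (intro continuous_intros)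
    show "eta_rate a b x > 0" for x by (rule erp)
  qed (auto simp: eta_rate_def L2_def eta_quarter_def)
  define A where "A = sqrt (2 * a)"
  \<comment> \<open>The sign gives \<open>\<eta>' 0\<close> the sign of \<open>b\<close>.\<close>
  define B where "B = sgn b * sqrt (eta_amp2 a b)"
  have A2: "A\<^sup>2 = 2 * a" using a by (simp add: A_def)
  have B2: "B\<^sup>2 = eta_amp2 a b"
  proof (cases "b = 0")
    case True
    then have "eta_amp2 a b = 0" using stark_energy_less[OF b] a by (simp add: eta_amp2_def)
    then show ?thesis by (simp add: B_def)
  next
    case False
    then show ?thesis using eta_amp2_nonneg[OF a, of b] by (simp add: B_def power_mult_distrib power2_eq_square[of "sgn b"] sgn_mult_self_eq)
  qed
  have root: "B\<^sup>2 * (B\<^sup>2 - 2 * h) = 2 * a * b\<^sup>2" unfolding B2 h_def by (rule eta_amp2_root[OF a])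
  have Bnz: "B \<noteq> 0" if "b \<noteq> 0" using root that a by auto
  have ah: "2 * a * h = a * b\<^sup>2 - 2 - 2 * a\<^sup>2"
    using a by (simp add: h_def stark_energy_def field_simps power2_eq_square)
  have xr: "xi_rate a b x = - 2 * h - 2 * A\<^sup>2 + A\<^sup>2 * (sin x)\<^sup>2" for x
    by (simp add: A2 xi_rate_def h_def stark_energy_def)
  have er: "eta_rate a b x = B\<^sup>2 * (1 + (sin x)\<^sup>2) - 2 * h" for x
    by (simp add: B2 eta_rate_def h_def)
  define \<xi> where "\<xi> s = A * cos (\<Phi> s)" for s
  define \<xi>' where "\<xi>' s = - A * sin (\<Phi> s) * sqrt (xi_rate a b (\<Phi> s))" for s
  define \<eta> where "\<eta> s = B * sin (\<Psi> s)" for s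
  define \<eta>' where "\<eta>' s = B * cos (\<Psi> s) * sqrt (eta_rate a b (\<Psi> s))" for s
  have D1: "(\<xi> has_real_derivative \<xi>' s) (at s)" for s
    unfolding \<xi>_def \<xi>'_def by (auto intro!: derivative_eq_intros \<Phi>(1))
  have D2: "(\<eta> has_real_derivative \<eta>' s) (at s)" for s
    unfolding \<eta>_def \<eta>'_def by (auto intro!: derivative_eq_intros \<Psi>(1))
  \<comment> \<open>The chain rule factor \<open>sqrt (w (f s))\<close> cancels the denominator, so
    the second derivatives of \<xi> and \<eta> are free of roots.\<close>
  have dsqrt: "((\<lambda>s. sqrt (w (f s))) has_real_derivative w' (f s) / 2) (at s)"
    if "\<And>x. w x > 0" "\<And>x. (w has_real_derivative w' x) (at x)"
      "(f has_real_derivative sqrt (w (f s))) (at s)" for w w' f :: "real \<Rightarrow> real" and s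
  proof -
    have "((\<lambda>s. sqrt (w (f s))) has_real_derivative inverse (sqrt (w (f s))) / 2 * (w' (f s) * sqrt (w (f s)))) (at s)"
      by (rule DERIV_chain2[OF DERIV_real_sqrt[OF that(1)] DERIV_chain2[OF that(2,3)]])
    then show ?thesis using that(1)[of "f s"] by (simp add: field_simps)
  qed
  have D3: "(\<xi>' has_real_derivative 2 * \<xi> s * (h + (\<xi> s)\<^sup>2)) (at s)" for s
  proof -
    have d: "(xi_rate a b has_real_derivative 2 * A\<^sup>2 * sin x * cos x) (at x)" for x
      unfolding xr by (auto intro!: derivative_eq_intros)
    note ds = dsqrt[OF xi_rate_pos[OF a b] d \<Phi>(1)[of s]]
    have sq: "sqrt (xi_rate a b (\<Phi> s)) * sqrt (xi_rate a b (\<Phi> s)) = xi_rate a b (\<Phi> s)"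
      using xi_rate_pos[OF a b, of "\<Phi> s"] by simp
    have "((\<lambda>s. - A * sin (\<Phi> s)) has_real_derivative - A * cos (\<Phi> s) * sqrt (xi_rate a b (\<Phi> s))) (at s)"
      by (auto intro!: derivative_eq_intros \<Phi>(1))
    from DERIV_mult[OF this ds]
    have "(\<xi>' has_real_derivative - A * cos (\<Phi> s) * (sqrt (xi_rate a b (\<Phi> s)) * sqrt (xi_rate a b (\<Phi> s)))
      + 2 * A\<^sup>2 * sin (\<Phi> s) * cos (\<Phi> s) / 2 * (- A * sin (\<Phi> s))) (at s)"
      by (simp add: \<xi>'_def[abs_def] mult.assoc)
    then show ?thesis
    proof (rule DERIV_cong)
      show "- A * cos (\<Phi> s) * (sqrt (xi_rate a b (\<Phi> s)) * sqrt (xi_rate a b (\<Phi> s)))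
      + 2 * A\<^sup>2 * sin (\<Phi> s) * cos (\<Phi> s) / 2 * (- A * sin (\<Phi> s)) = 2 * \<xi> s * (h + (\<xi> s)\<^sup>2)"
        unfolding sq unfolding xr \<xi>_def using sin_cos_squared_add[of "\<Phi> s"] by algebra
    qed
  qed
  have D4: "(\<eta>' has_real_derivative 2 * \<eta> s * (h - (\<eta> s)\<^sup>2)) (at s)" for s
  proof -
    have d: "(eta_rate a b has_real_derivative 2 * B\<^sup>2 * sin x * cos x) (at x)" for x
      unfolding er by (auto intro!: derivative_eq_intros)
    note ds = dsqrt[OF erp d \<Psi>(1)[of s]]
    have sq: "sqrt (eta_rate a b (\<Psi> s)) * sqrt (eta_rate a b (\<Psi> s)) = eta_rate a b (\<Psi> s)"
      using erp[of "\<Psi> s"] by simp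
    have "((\<lambda>s. B * cos (\<Psi> s)) has_real_derivative - B * sin (\<Psi> s) * sqrt (eta_rate a b (\<Psi> s))) (at s)"
      by (auto intro!: derivative_eq_intros \<Psi>(1))
    from DERIV_mult[OF this ds]
    have "(\<eta>' has_real_derivative - B * sin (\<Psi> s) * (sqrt (eta_rate a b (\<Psi> s)) * sqrt (eta_rate a b (\<Psi> s)))
      + 2 * B\<^sup>2 * sin (\<Psi> s) * cos (\<Psi> s) / 2 * (B * cos (\<Psi> s))) (at s)"
      by (simp add: \<eta>'_def[abs_def] mult.assoc)
    then show ?thesis
    proof (rule DERIV_cong)
      show "- B * sin (\<Psi> s) * (sqrt (eta_rate a b (\<Psi> s)) * sqrt (eta_rate a b (\<Psi> s)))
      + 2 * B\<^sup>2 * sin (\<Psi> s) * cos (\<Psi> s) / 2 * (B * cos (\<Psi> s)) = 2 * \<eta> s * (h - (\<eta> s)\<^sup>2)"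
        unfolding sq unfolding er \<eta>_def using sin_cos_squared_add[of "\<Psi> s"] by algebra
    qed
  qed
  \<comment> \<open>Each coordinate has its own energy integral; by \<open>ah\<close> the two
    constants add up to 4.\<close>
  have energy: "(\<xi>' s)\<^sup>2 + (\<eta>' s)\<^sup>2 = 4 + 2 * h * ((\<xi> s)\<^sup>2 + (\<eta> s)\<^sup>2) + \<xi> s ^ 4 - \<eta> s ^ 4" for s
  proof -
    have "(\<xi>' s)\<^sup>2 = A\<^sup>2 * (sin (\<Phi> s))\<^sup>2 * xi_rate a b (\<Phi> s)"
      using xi_rate_pos[OF a b, of "\<Phi> s"] by (simp add: \<xi>'_def power_mult_distrib)
    also have "\<dots> = 2 * h * ((\<xi> s)\<^sup>2 - A\<^sup>2) + \<xi> s ^ 4 - A ^ 4"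
      unfolding xr \<xi>_def using sin_cos_squared_add[of "\<Phi> s"] by algebra
    finally have 1: "(\<xi>' s)\<^sup>2 = 2 * h * ((\<xi> s)\<^sup>2 - A\<^sup>2) + \<xi> s ^ 4 - A ^ 4" .
    have "(\<eta>' s)\<^sup>2 = B\<^sup>2 * (cos (\<Psi> s))\<^sup>2 * eta_rate a b (\<Psi> s)"
      using erp[of "\<Psi> s"] by (simp add: \<eta>'_def power_mult_distrib)
    also have "\<dots> = 2 * h * (\<eta> s)\<^sup>2 - \<eta> s ^ 4 + B\<^sup>2 * (B\<^sup>2 - 2 * h)"
      unfolding er \<eta>_def using sin_cos_squared_add[of "\<Psi> s"] by algebra
    finally have 2: "(\<eta>' s)\<^sup>2 = 2 * h * (\<eta> s)\<^sup>2 - \<eta> s ^ 4 + 2 * a * b\<^sup>2" unfolding root .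
    have "A ^ 4 = 4 * a\<^sup>2" using A2 by algebra
    then show ?thesis unfolding 1 2 A2 using ah by algebra
  qed
  have "continuous_on UNIV (\<lambda>s. (\<xi> s)\<^sup>2 + (\<eta> s)\<^sup>2)"
    using D1 D2 by (intro continuous_intros DERIV_continuous_on) (auto intro: has_field_derivative_at_within)
  then obtain \<tau> where \<tau>: "\<And>s. (\<tau> has_real_derivative (\<xi> s)\<^sup>2 + (\<eta> s)\<^sup>2) (at s)" "\<tau> 0 = 0"
    using exists_antiderivative by blast
  have z: "\<Phi> 0 = 0" "\<Psi> 0 = 0" using \<Phi>(3)[of 0] \<Psi>(3)[of 0] by simp_all
  show thesis
  proof (rule that[of \<xi> \<eta> \<xi>' \<eta>' \<tau>], unfold_locales, unfold h_def[symmetric] L1_def[symmetric] L2_def[symmetric])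
    show "\<eta>' 0 = b * sqrt (2 * a)"
    proof -
      have "sqrt (eta_amp2 a b) * sqrt (eta_rate a b 0) = sqrt (2 * a * b\<^sup>2)"
        unfolding real_sqrt_mult[symmetric] er using root B2 by simp
      also have "\<dots> = sqrt (2 * a) * \<bar>b\<bar>" by (simp add: real_sqrt_mult)
      finally have "\<eta>' 0 = sgn b * \<bar>b\<bar> * sqrt (2 * a)" by (simp add: \<eta>'_def z B_def)
      then show ?thesis by (simp add: sgn_mult_abs)
    qed
    show "\<xi> s > 0" if "\<bar>s\<bar> < L1" for s
    proof -
      have "\<Phi> s < \<Phi> (of_int 1 * L1)" "\<Phi> (of_int (-1) * L1) < \<Phi> s"
        using that by (auto intro!: strict_monoD[OF \<Phi>(2)])
      then have "cos (\<Phi> s) > 0" unfolding \<Phi>(3) by (intro cos_gt_zero_pi) auto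
      then show ?thesis using a by (simp add: \<xi>_def A_def)
    qed
    show "\<xi> s = 0 \<longleftrightarrow> (\<exists>i::int. odd i \<and> s = of_int i * L1)" for s
    proof -
      have "\<xi> s = 0 \<longleftrightarrow> (\<exists>i::int. odd i \<and> \<Phi> s = of_int i * (pi / 2))"
        using a by (simp add: \<xi>_def A_def cos_zero_iff_int)
      also have "\<dots> \<longleftrightarrow> (\<exists>i::int. odd i \<and> s = of_int i * L1)"
        unfolding \<Phi>(3)[symmetric] strict_mono_eq[OF \<Phi>(2)] ..
      finally show ?thesis .
    qed
    show "\<eta> (2 * of_int j * L2) = 0" for j :: int
      using \<Psi>(3)[of "2 * j"] by (simp add: \<eta>_def sin_zero_iff_int2)
    show "\<exists>j::int. s = 2 * of_int j * L2" if b0: "b \<noteq> 0" and \<eta>0: "\<eta> s = 0" for s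
    proof -
      obtain j :: int where "\<Psi> s = of_int j * pi"
        using \<eta>0 Bnz[OF b0] by (auto simp: \<eta>_def sin_zero_iff_int2)
      then have "\<Psi> s = \<Psi> (of_int (2 * j) * L2)" unfolding \<Psi>(3) by simp
      then show ?thesis unfolding strict_mono_eq[OF \<Psi>(2)] by auto
    qed
    show "\<eta>' ((2 * of_int j + 1) * L2) = 0" for j :: int
    proof -
      have "\<Psi> ((2 * of_int j + 1) * L2) = of_int (2 * j + 1) * (pi / 2)" using \<Psi>(3)[of "2 * j + 1"] by simp
      moreover have "odd (2 * j + 1)" by simp
      ultimately have "cos (\<Psi> ((2 * of_int j + 1) * L2)) = 0" unfolding cos_zero_iff_int by blast
      then show ?thesis by (simp add: \<eta>'_def)
    qed
    show "\<xi> (s + 4 * L1) = \<xi> s" for s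
      using \<Phi>(4)[of s 2] by (simp add: \<xi>_def)
    show "\<eta> (s + of_nat n * (4 * L2)) = \<eta> s" for s and n :: nat
    proof -
      have "\<Psi> (s + of_nat n * (4 * L2)) = \<Psi> s + of_nat n * (2 * pi)" using \<Psi>(4)[of s "2 * n"] by (simp add: algebra_simps)
      then show ?thesis
        using cos_int_2pin[of "int n"] sin_int_2pin[of "int n"] by (simp add: \<eta>_def sin_add mult_ac)
    qed
  qed (use a D1 D2 D3 D4 energy \<tau> \<Phi>(5) \<Psi>(5) in \<open>auto simp: z \<xi>_def \<eta>_def \<xi>'_def A_def\<close>)
qed

section \<open>Orbits in physical time\<close>

context parabolic_orbit
begin

definition px :: "real \<Rightarrow> real" where "px s = ((\<xi> s)\<^sup>2 - (\<eta> s)\<^sup>2) / 2"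
definition py :: "real \<Rightarrow> real" where "py s = \<xi> s * \<eta> s"
definition pu :: "real \<Rightarrow> real" where "pu s = (\<xi> s * \<xi>' s - \<eta> s * \<eta>' s) / ((\<xi> s)\<^sup>2 + (\<eta> s)\<^sup>2)"
definition pv :: "real \<Rightarrow> real" where "pv s = (\<xi>' s * \<eta> s + \<xi> s * \<eta>' s) / ((\<xi> s)\<^sup>2 + (\<eta> s)\<^sup>2)"

lemma stark_sol_reparam:
  assumes g: "\<And>t. t \<in> I \<Longrightarrow> (g has_real_derivative 1 / ((\<xi> (g t))\<^sup>2 + (\<eta> (g t))\<^sup>2)) (at t)"
    and pos: "\<And>t. t \<in> I \<Longrightarrow> (\<xi> (g t))\<^sup>2 + (\<eta> (g t))\<^sup>2 > 0"
  shows "stark_sol (\<lambda>t. px (g t)) (\<lambda>t. py (g t)) (\<lambda>t. pu (g t)) (\<lambda>t. pv (g t)) I"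
  unfolding px_def py_def pu_def pv_def
proof (rule parabolic_stark_sol[where h = h])
  fix t assume t: "t \<in> I"
  show "((\<lambda>t. \<xi> (g t)) has_real_derivative \<xi>' (g t) / ((\<xi> (g t))\<^sup>2 + (\<eta> (g t))\<^sup>2)) (at t within I)"
    using DERIV_chain2[OF D\<xi> g[OF t]] by (auto intro: has_field_derivative_at_within)
  show "((\<lambda>t. \<eta> (g t)) has_real_derivative \<eta>' (g t) / ((\<xi> (g t))\<^sup>2 + (\<eta> (g t))\<^sup>2)) (at t within I)"
    using DERIV_chain2[OF D\<eta> g[OF t]] by (auto intro: has_field_derivative_at_within)
  show "((\<lambda>t. \<xi>' (g t)) has_real_derivative 2 * \<xi> (g t) * (h + (\<xi> (g t))\<^sup>2) / ((\<xi> (g t))\<^sup>2 + (\<eta> (g t))\<^sup>2)) (at t within I)"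
    using DERIV_chain2[OF D\<xi>' g[OF t]] by (auto intro: has_field_derivative_at_within)
  show "((\<lambda>t. \<eta>' (g t)) has_real_derivative 2 * \<eta> (g t) * (h - (\<eta> (g t))\<^sup>2) / ((\<xi> (g t))\<^sup>2 + (\<eta> (g t))\<^sup>2)) (at t within I)"
    using DERIV_chain2[OF D\<eta>' g[OF t]] by (auto intro: has_field_derivative_at_within)
qed (use energy pos in auto)

lemma stark_init_reparam:
  assumes "g 0 = 0"
  shows "stark_init (\<lambda>t. px (g t)) (\<lambda>t. py (g t)) (\<lambda>t. pu (g t)) (\<lambda>t. pv (g t)) a b"
proof -
  define c where "c = sqrt (2 * a)"
  have c: "c \<noteq> 0" "c\<^sup>2 = 2 * a" using a_pos by (auto simp: c_def)
  note init' = init[folded c_def]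
  have "pv 0 = b" using c(1) by (simp add: pv_def init' power2_eq_square)
  moreover have "px 0 = a" "py 0 = 0" "pu 0 = 0" by (simp_all add: px_def py_def pu_def init' c(2))
  ultimately show ?thesis by (simp add: stark_init_def assms)
qed

text \<open>The derivative of \<tau> is positive as long as \<xi> is. It may vanish at the endpoint
  \<open>L1\<close>, which is the collision case, so only continuity is used there.\<close>

lemma \<tau>_less:
  assumes "0 \<le> r" "r < s" "s \<le> L1"
  shows "\<tau> r < \<tau> s"
proof (rule DERIV_pos_imp_increasing_open[OF assms(2)])
  fix x assume "r < x" "x < s"
  then have "\<xi> x > 0" using assms by (intro \<xi>_pos) auto
  then have "(\<xi> x)\<^sup>2 + (\<eta> x)\<^sup>2 > 0" by (simp add: add_pos_nonneg)
  then show "\<exists>y. (\<tau> has_real_derivative y) (at x) \<and> 0 < y" using D\<tau> by blast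
qed (rule DERIV_continuous_on[OF has_field_derivative_at_within[OF D\<tau>]])

lemma \<tau>_surj:
  assumes "0 \<le> t" "t \<le> \<tau> S" "0 \<le> S"
  obtains s where "0 \<le> s" "s \<le> S" "\<tau> s = t"
  using IVT[of \<tau> 0 t S] assms \<tau>_0 D\<tau> DERIV_isCont by metis

text \<open>Before \<open>L1\<close> the factor \<xi> of \<open>py\<close> is positive, so crossings
  are zeros of \<eta>, at \<open>s = 2 * n * L2\<close>. Counting starts at \<open>n = 1\<close>
  because the initial point is excluded, and \<open>L1 \<le> 2 * (k + 1) * L2\<close> rules out a
  further one.\<close>

lemma positive_axis_crossings:
  assumes g: "\<And>s. 0 \<le> s \<Longrightarrow> s < L1 \<Longrightarrow> g (\<tau> s) = s"
  defines "H \<equiv> {t \<in> {0<..<\<tau> L1}. py (g t) = 0 \<and> px (g t) > 0}"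
  shows "2 * real k * L2 < L1 \<Longrightarrow> (\<lambda>n. \<tau> (2 * real n * L2)) ` {1..k} \<subseteq> H"
    and "2 * real k * L2 < L1 \<Longrightarrow> inj_on (\<lambda>n. \<tau> (2 * real n * L2)) {1..k}"
    and "b \<noteq> 0 \<Longrightarrow> 2 * real k * L2 < L1 \<Longrightarrow> L1 \<le> 2 * (real k + 1) * L2 \<Longrightarrow>
      H = (\<lambda>n. \<tau> (2 * real n * L2)) ` {1..k}"
proof -
  have less: "2 * real n * L2 < L1" if "2 * real k * L2 < L1" "n \<le> k" for n
  proof -
    have "2 * real n * L2 \<le> 2 * real k * L2" using that L_pos by (intro mult_right_mono) auto
    then show ?thesis using that by linarith
  qed
  show sub: "(\<lambda>n. \<tau> (2 * real n * L2)) ` {1..k} \<subseteq> H" if k: "2 * real k * L2 < L1"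
  proof clarify
    fix n assume n: "n \<in> {1..k}"
    let ?s = "2 * real n * L2"
    have s: "0 < ?s" "?s < L1" using n less[OF k, of n] L_pos by auto
    have "\<eta> ?s = 0" using \<eta>_zero[of "int n"] by simp
    moreover have "\<xi> ?s > 0" using s by (intro \<xi>_pos) auto
    ultimately have "py ?s = 0" "px ?s > 0" by (auto simp: px_def py_def)
    moreover have "0 < \<tau> ?s" "\<tau> ?s < \<tau> L1" using \<tau>_less[of 0 ?s] \<tau>_less[of ?s L1] s \<tau>_0 by auto
    ultimately show "\<tau> ?s \<in> H" using g[of ?s] s by (simp add: H_def)
  qed
  show "inj_on (\<lambda>n. \<tau> (2 * real n * L2)) {1..k}" if k: "2 * real k * L2 < L1"
  proof (rule inj_onI)
    fix m n assume mn: "m \<in> {1..k}" "n \<in> {1..k}" "\<tau> (2 * real m * L2) = \<tau> (2 * real n * L2)"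
    have "2 * real m * L2 = 2 * real n * L2"
    proof -
      have "g (\<tau> (2 * real m * L2)) = 2 * real m * L2" "g (\<tau> (2 * real n * L2)) = 2 * real n * L2"
        using mn(1,2) less[OF k, of m] less[OF k, of n] L_pos by (auto intro!: g)
      with mn(3) show ?thesis by metis
    qed
    then show "m = n" using L_pos by simp
  qed
  show "H = (\<lambda>n. \<tau> (2 * real n * L2)) ` {1..k}"
    if b: "b \<noteq> 0" and k: "2 * real k * L2 < L1" "L1 \<le> 2 * (real k + 1) * L2"
  proof (rule antisym[OF subsetI sub[OF k(1)]])
    fix t assume t: "t \<in> H"
    then obtain s where s: "0 \<le> s" "s \<le> L1" "\<tau> s = t" using \<tau>_surj[of t L1] L_pos by (auto simp: H_def)
    with t \<tau>_0 have "s \<noteq> 0" "s \<noteq> L1" by (auto simp: H_def)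
    with s have s': "0 < s" "s < L1" by auto
    then have "\<xi> s > 0" by (intro \<xi>_pos) auto
    moreover have "py s = 0" using t g[of s] s s' by (auto simp: H_def)
    ultimately have "\<eta> s = 0" by (simp add: py_def)
    then obtain j :: int where j: "s = 2 * of_int j * L2" using \<eta>_zeroD[OF b] by blast
    then have "0 < j" using s' L_pos by (simp add: zero_less_mult_iff)
    moreover have "j \<le> int k"
    proof -
      have "2 * of_int j * L2 < 2 * (real k + 1) * L2" using s' j k by linarith
      then have "of_int j < real k + 1" using L_pos by simp
      then show ?thesis by linarith
    qed
    ultimately have "nat j \<in> {1..k}" "s = 2 * real (nat j) * L2" using j by auto
    with s(3) show "t \<in> (\<lambda>n. \<tau> (2 * real n * L2)) ` {1..k}" by blast
  qed
qed

text \<open>No collision happens before the first zero of \<xi>, whatever \<open>b\<close> is, so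
  the time change can be inverted up to there.\<close>

lemma solution_until_\<xi>_zero:
  obtains g where "\<And>s. 0 \<le> s \<Longrightarrow> s < L1 \<Longrightarrow> g (\<tau> s) = s"
    "stark_sol (\<lambda>t. px (g t)) (\<lambda>t. py (g t)) (\<lambda>t. pu (g t)) (\<lambda>t. pv (g t)) {0..<\<tau> L1}"
    "stark_init (\<lambda>t. px (g t)) (\<lambda>t. py (g t)) (\<lambda>t. pu (g t)) (\<lambda>t. pv (g t)) a b"
    "\<And>t. t \<in> {0..<\<tau> L1} \<Longrightarrow> 0 \<le> g t \<and> g t < L1 \<and> \<tau> (g t) = t"
proof -
  have pos: "(\<xi> s)\<^sup>2 + (\<eta> s)\<^sup>2 > 0" if "s \<in> {-L1<..<L1}" for s
  proof -
    have "\<xi> s > 0" using that by (intro \<xi>_pos) auto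
    then show ?thesis by (simp add: add_pos_nonneg)
  qed
  \<comment> \<open>The symmetric interval makes time 0 an interior point.\<close>
  obtain g where g: "\<And>s. s \<in> {-L1<..<L1} \<Longrightarrow> g (\<tau> s) = s"
    "\<And>s. s \<in> {-L1<..<L1} \<Longrightarrow> (g has_real_derivative 1 / ((\<xi> s)\<^sup>2 + (\<eta> s)\<^sup>2)) (at (\<tau> s))"
    using inverse_of_increasing[OF open_greaterThanLessThan is_interval_oo D\<tau> pos] by blast
  have gt: "0 \<le> g t \<and> g t < L1 \<and> \<tau> (g t) = t" if t: "t \<in> {0..<\<tau> L1}" for t
  proof -
    obtain s where s: "0 \<le> s" "s \<le> L1" "\<tau> s = t" using \<tau>_surj[of t L1] L_pos t by auto
    with t have "s \<noteq> L1" by auto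
    then show ?thesis using s g(1)[of s] L_pos by auto
  qed
  show thesis
  proof (rule that)
    show "g (\<tau> s) = s" if "0 \<le> s" "s < L1" for s using that g(1)[of s] L_pos by auto
    show "stark_sol (\<lambda>t. px (g t)) (\<lambda>t. py (g t)) (\<lambda>t. pu (g t)) (\<lambda>t. pv (g t)) {0..<\<tau> L1}"
    proof (rule stark_sol_reparam)
      fix t assume "t \<in> {0..<\<tau> L1}"
      then have t: "g t \<in> {-L1<..<L1}" "\<tau> (g t) = t" using gt[of t] L_pos by auto
      show "(g has_real_derivative 1 / ((\<xi> (g t))\<^sup>2 + (\<eta> (g t))\<^sup>2)) (at t)" using g(2)[OF t(1)] t(2) by simp
      show "(\<xi> (g t))\<^sup>2 + (\<eta> (g t))\<^sup>2 > 0" by (rule pos[OF t(1)])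
    qed
    show "stark_init (\<lambda>t. px (g t)) (\<lambda>t. py (g t)) (\<lambda>t. pu (g t)) (\<lambda>t. pv (g t)) a b"
      using g(1)[of 0] \<tau>_0 L_pos by (intro stark_init_reparam) simp
  qed (rule gt)
qed

text \<open>The hypothesis on \<open>L1\<close> makes \<eta> vanish together with \<xi> at the first
  zero of \<xi>, after exactly \<open>k\<close> earlier positive zeros of \<eta>.\<close>

lemma collision:
  assumes b: "b \<noteq> 0" and L: "L1 = 2 * (real k + 1) * L2"
  shows "collision_B a b k"
proof -
  obtain g where g: "\<And>s. 0 \<le> s \<Longrightarrow> s < L1 \<Longrightarrow> g (\<tau> s) = s"
    "stark_sol (\<lambda>t. px (g t)) (\<lambda>t. py (g t)) (\<lambda>t. pu (g t)) (\<lambda>t. pv (g t)) {0..<\<tau> L1}"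
    "stark_init (\<lambda>t. px (g t)) (\<lambda>t. py (g t)) (\<lambda>t. pu (g t)) (\<lambda>t. pv (g t)) a b"
    "\<And>t. t \<in> {0..<\<tau> L1} \<Longrightarrow> 0 \<le> g t \<and> g t < L1 \<and> \<tau> (g t) = t"
    using solution_until_\<xi>_zero by blast
  have T: "\<tau> L1 > 0" using \<tau>_less[of 0 L1] L_pos \<tau>_0 by simp
  have "2 * real k * L2 < L1" using L L_pos by (simp add: algebra_simps)
  note H = positive_axis_crossings(1,2)[OF g(1) this] positive_axis_crossings(3)[OF g(1) b this]
  \<comment> \<open>Since \<tau> increases, \<open>t > \<tau> m\<close> forces
    \<open>g t > m\<close>; with \<open>g t < L1\<close> this pins the limit.\<close>
  have lim: "(g \<longlongrightarrow> L1) (at_left (\<tau> L1))"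
  proof (rule order_tendstoI)
    fix l assume l: "l < L1"
    define m where "m = max l 0"
    have m: "l \<le> m" "0 \<le> m" "m < L1" using l L_pos by (auto simp: m_def)
    have "\<tau> m < \<tau> L1" by (rule \<tau>_less) (use m in auto)
    then show "eventually (\<lambda>t. l < g t) (at_left (\<tau> L1))"
      unfolding eventually_at_left[OF T]
    proof (intro exI conjI allI impI)
      fix t assume t: "\<tau> m < t" "t < \<tau> L1"
      have "0 \<le> \<tau> m" using \<tau>_less[of 0 m] m \<tau>_0 by (cases "m = 0") auto
      then have gt: "0 \<le> g t" "g t < L1" "\<tau> (g t) = t" using g(4)[of t] t by auto
      have "\<not> g t \<le> m"
      proof
        assume "g t \<le> m"
        then have "\<tau> (g t) \<le> \<tau> m" using \<tau>_less[of "g t" m] gt m by (cases "g t = m") auto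
        then show False using gt t by simp
      qed
      then show "l < g t" using m by linarith
    qed
  next
    fix l assume l: "L1 < l"
    show "eventually (\<lambda>t. g t < l) (at_left (\<tau> L1))"
      unfolding eventually_at_left[OF T]
    proof (intro exI conjI allI impI)
      fix t assume "0 < t" "t < \<tau> L1"
      then show "g t < l" using g(4)[of t] l by auto
    qed (rule T)
  qed
  have z: "\<xi> L1 = 0" using \<xi>_zero[of L1] by (metis mult_1 odd_one of_int_1)
  have z': "\<eta> L1 = 0" using \<eta>_zero[of "int k + 1"] L by simp
  have "isCont \<xi> L1" "isCont \<eta> L1" using D\<xi> D\<eta> DERIV_isCont by blast+
  then have "((\<lambda>t. \<xi> (g t)) \<longlongrightarrow> 0) (at_left (\<tau> L1))" "((\<lambda>t. \<eta> (g t)) \<longlongrightarrow> 0) (at_left (\<tau> L1))"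
    using lim isCont_tendsto_compose z z' by metis+
  then have "((\<lambda>t. (px (g t), py (g t))) \<longlongrightarrow> ((0\<^sup>2 - 0\<^sup>2) / 2, 0 * 0)) (at_left (\<tau> L1))"
    unfolding px_def py_def by (intro tendsto_intros) auto
  then have lim0: "((\<lambda>t. (px (g t), py (g t))) \<longlongrightarrow> (0, 0)) (at_left (\<tau> L1))" by simp
  have Hs: "{t \<in> {0<..<\<tau> L1}. py (g t) = 0 \<and> px (g t) > 0} = (\<lambda>n. \<tau> (2 * real n * L2)) ` {1..k}"
    using H(3) L by simp
  show ?thesis
    unfolding collision_B_def
  proof (intro exI conjI)
    show "finite {t \<in> {0<..<\<tau> L1}. py (g t) = 0 \<and> px (g t) > 0}" unfolding Hs by simp
    show "card {t \<in> {0<..<\<tau> L1}. py (g t) = 0 \<and> px (g t) > 0} = k"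
      unfolding Hs using card_image[OF H(2)] by simp
  qed (fact T g(2,3) lim0)+
qed

text \<open>At \<open>L1\<close>, an odd multiple of \<open>L2\<close>, \<xi> and
  \<open>\<eta>'\<close> vanish together, which makes the crossing of the negative axis
  perpendicular. The same relation makes \<open>4 * L1\<close> a period of both coordinates.\<close>

lemma periodic:
  assumes b: "b \<noteq> 0" and L: "L1 = (2 * real k + 1) * L2"
  shows "periodic_A a b k"
proof -
  \<comment> \<open>Parity excludes collisions: a common zero would give
    \<open>i * (2 * k + 1) = 2 * j\<close> with \<open>i\<close> odd.\<close>
  have pos: "(\<xi> s)\<^sup>2 + (\<eta> s)\<^sup>2 > 0" for s
  proof (rule ccontr)
    assume "\<not> (\<xi> s)\<^sup>2 + (\<eta> s)\<^sup>2 > 0"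
    then have "\<xi> s = 0" "\<eta> s = 0" by (auto simp: sum_power2_gt_zero_iff)
    then obtain i j :: int where ij: "odd i" "s = of_int i * L1" "s = 2 * of_int j * L2"
      using \<xi>_zero \<eta>_zeroD[OF b] by blast
    then have "of_int i * (2 * real k + 1) * L2 = 2 * of_int j * L2" using L by (auto simp: mult.assoc)
    then have "of_int (i * (2 * int k + 1)) = (of_int (2 * j) :: real)" using L_pos by simp
    then have "i * (2 * int k + 1) = 2 * j" by (simp only: of_int_eq_iff)
    then have "even (i * (2 * int k + 1))" by simp
    then show False using ij(1) by simp
  qed
  obtain g where g: "\<And>s. g (\<tau> s) = s"
    "\<And>s. (g has_real_derivative 1 / ((\<xi> s)\<^sup>2 + (\<eta> s)\<^sup>2)) (at (\<tau> s))" and mono: "strict_mono \<tau>"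
    using inverse_of_increasing[of UNIV \<tau> "\<lambda>s. (\<xi> s)\<^sup>2 + (\<eta> s)\<^sup>2"] D\<tau> pos by auto
  have \<eta>per: "\<eta> (s + 4 * L1) = \<eta> s" for s
    using \<eta>_periodic[of s "2 * k + 1"] L by (simp add: algebra_simps)
  define P where "P = \<tau> (4 * L1)"
  have P: "P > 0" using strict_monoD[OF mono, of 0 "4 * L1"] L_pos \<tau>_0 by (simp add: P_def)
  have shift: "\<tau> (s + 4 * L1) = \<tau> s + P" for s
  proof -
    have "((\<lambda>s. \<tau> (s + 4 * L1) - \<tau> s) has_real_derivative 0) (at s)" for s
      by (rule derivative_eq_intros DERIV_chain2[OF D\<tau>] D\<tau> refl | simp add: \<eta>per \<xi>_periodic)+
    from DERIV_isconst_all[of "\<lambda>s. \<tau> (s + 4 * L1) - \<tau> s" s 0] this show ?thesis by (simp add: \<tau>_0 P_def)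
  qed
  have shiftn: "\<tau> (real n * (4 * L1)) = real n * P" for n
  proof (induction n)
    case (Suc n)
    then show ?case using shift[of "real n * (4 * L1)"] by (simp add: algebra_simps)
  qed (simp add: \<tau>_0)
  \<comment> \<open>Physical time gains \<open>P > 0\<close> per period, so the orbit is defined for
    all \<open>t \<ge> 0\<close>.\<close>
  have surj: "\<exists>s\<ge>0. \<tau> s = t" if "0 \<le> t" for t
  proof -
    obtain n where n: "t < real n * P" using ex_less_of_nat_mult[OF P] by blast
    then show ?thesis using \<tau>_surj[of t "real n * (4 * L1)"] that L_pos unfolding shiftn by auto
  qed
  have T: "\<tau> L1 > 0" using \<tau>_less[of 0 L1] L_pos \<tau>_0 by simp
  have "2 * real k * L2 < L1" using L L_pos by (simp add: algebra_simps)
  note H = positive_axis_crossings(1,2)[OF g(1) this] positive_axis_crossings(3)[OF g(1) b this]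
  have Hs: "{t \<in> {0<..<\<tau> L1}. py (g t) = 0 \<and> px (g t) > 0} = (\<lambda>n. \<tau> (2 * real n * L2)) ` {1..k}"
    using H(3) L L_pos by (simp add: algebra_simps)
  have z: "\<xi> L1 = 0" using \<xi>_zero[of L1] by (metis mult_1 odd_one of_int_1)
  have z': "\<eta> L1 \<noteq> 0" using pos[of L1] z by auto
  have z'': "\<eta>' L1 = 0" using \<eta>'_zero[of "int k"] L by simp
  have sol: "stark_sol (\<lambda>t. px (g t)) (\<lambda>t. py (g t)) (\<lambda>t. pu (g t)) (\<lambda>t. pv (g t)) {0..}"
  proof (rule stark_sol_reparam)
    fix t :: real assume "t \<in> {0..}"
    then obtain s where "\<tau> s = t" using surj by auto
    then show "(g has_real_derivative 1 / ((\<xi> (g t))\<^sup>2 + (\<eta> (g t))\<^sup>2)) (at t)" using g by metis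
  qed (rule pos)
  have ini: "stark_init (\<lambda>t. px (g t)) (\<lambda>t. py (g t)) (\<lambda>t. pu (g t)) (\<lambda>t. pv (g t)) a b"
    using g(1)[of 0] \<tau>_0 by (intro stark_init_reparam) simp
  have per: "px (g (t + P)) = px (g t) \<and> py (g (t + P)) = py (g t)" if "0 \<le> t" for t
  proof -
    obtain s where "\<tau> s = t" using surj \<open>0 \<le> t\<close> by blast
    then have "g t = s" "g (t + P) = s + 4 * L1" using g(1) shift by metis+
    then show ?thesis by (simp add: px_def py_def \<eta>per \<xi>_periodic)
  qed
  have noneg: "\<not> (py (g t) = 0 \<and> px (g t) < 0)" if "t \<in> {0<..<\<tau> L1}" for t
  proof -
    obtain s where s: "0 \<le> s" "s \<le> L1" "\<tau> s = t" using \<tau>_surj[of t L1] L_pos \<open>t \<in> _\<close> by auto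
    with \<open>t \<in> _\<close> have "s \<noteq> L1" by auto
    with s have "\<xi> s > 0" by (intro \<xi>_pos) auto
    moreover have "g t = s" using s g by auto
    ultimately show ?thesis by (auto simp: px_def py_def)
  qed
  have at_T: "py (g (\<tau> L1)) = 0" "px (g (\<tau> L1)) < 0" "pu (g (\<tau> L1)) = 0"
    using z z' z'' by (simp_all add: g py_def px_def pu_def)
  show ?thesis
    unfolding periodic_A_def
  proof (intro exI conjI)
    show "stark_sol (\<lambda>t. px (g t)) (\<lambda>t. py (g t)) (\<lambda>t. pu (g t)) (\<lambda>t. pv (g t)) {0..}"
      "stark_init (\<lambda>t. px (g t)) (\<lambda>t. py (g t)) (\<lambda>t. pu (g t)) (\<lambda>t. pv (g t)) a b" by fact+
    show "P > 0" "\<tau> L1 > 0" by fact+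
    show "\<forall>t\<ge>0. px (g (t + P)) = px (g t) \<and> py (g (t + P)) = py (g t)" using per by blast
    show "\<forall>t\<in>{0<..<\<tau> L1}. \<not> (py (g t) = 0 \<and> px (g t) < 0)" using noneg by blast
    show "finite {t \<in> {0<..<\<tau> L1}. py (g t) = 0 \<and> px (g t) > 0}" unfolding Hs by simp
    show "card {t \<in> {0<..<\<tau> L1}. py (g t) = 0 \<and> px (g t) > 0} = k"
      unfolding Hs using card_image[OF H(2)] by simp
  qed (fact at_T)+
qed

text \<open>By uniqueness, whatever solution witnesses \<open>periodic_A\<close> follows the
  parabolic orbit up to \<open>\<tau> L1\<close>. As \<xi> is positive until then, the negative axis
  is not met earlier, and the first \<open>n\<close> positive crossings all count.\<close>

lemma crossings_lower_bound:
  assumes A: "periodic_A a b k" and n: "2 * real n * L2 < L1"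
  shows "n \<le> k"
proof -
  obtain x y u v T where sol: "stark_sol x y u v {0..}" "stark_init x y u v a b"
    and T: "T > 0" "y T = 0" "x T < 0"
    and fin: "finite {t\<in>{0<..<T}. y t = 0 \<and> x t > 0}"
    and card: "card {t\<in>{0<..<T}. y t = 0 \<and> x t > 0} = k"
    using A unfolding periodic_A_def by blast
  obtain g where g: "\<And>s. 0 \<le> s \<Longrightarrow> s < L1 \<Longrightarrow> g (\<tau> s) = s"
    "stark_sol (\<lambda>t. px (g t)) (\<lambda>t. py (g t)) (\<lambda>t. pu (g t)) (\<lambda>t. pv (g t)) {0..<\<tau> L1}"
    "stark_init (\<lambda>t. px (g t)) (\<lambda>t. py (g t)) (\<lambda>t. pu (g t)) (\<lambda>t. pv (g t)) a b"
    "\<And>t. t \<in> {0..<\<tau> L1} \<Longrightarrow> 0 \<le> g t \<and> g t < L1 \<and> \<tau> (g t) = t"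
    using solution_until_\<xi>_zero by blast
  have eq: "x t = px (g t)" "y t = py (g t)" if t: "t \<in> {0..<\<tau> L1}" for t
  proof -
    have sub: "{0..t} \<subseteq> {0..}" "{0..t} \<subseteq> {0..<\<tau> L1}" "0 \<le> t" using t by auto
    show "x t = px (g t)" "y t = py (g t)"
      using stark_sol_unique[OF stark_sol_subset[OF sol(1) sub(1)] stark_sol_subset[OF g(2) sub(2)] sol(2) g(3) sub(3)]
      by auto
  qed
  have "\<tau> L1 \<le> T"
  proof (rule ccontr)
    assume "\<not> \<tau> L1 \<le> T"
    then have T': "T \<in> {0..<\<tau> L1}" using T by auto
    then have "\<xi> (g T) > 0" using g(4)[OF T'] by (intro \<xi>_pos) auto
    then have "\<eta> (g T) = 0" using eq(2)[OF T'] T by (simp add: py_def)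
    then have "x T = (\<xi> (g T))\<^sup>2 / 2" using eq(1)[OF T'] by (simp add: px_def)
    then show False using T(3) zero_le_power2[of "\<xi> (g T)"] by linarith
  qed
  then have "{t \<in> {0<..<\<tau> L1}. py (g t) = 0 \<and> px (g t) > 0} \<subseteq> {t\<in>{0<..<T}. y t = 0 \<and> x t > 0}"
    using eq by auto
  with positive_axis_crossings(1)[OF g(1) n]
  have "(\<lambda>n. \<tau> (2 * real n * L2)) ` {1..n} \<subseteq> {t\<in>{0<..<T}. y t = 0 \<and> x t > 0}" by blast
  from card_mono[OF fin this] show ?thesis
    using card_image[OF positive_axis_crossings(2)[OF g(1) n]] card by simp
qed

end

section \<open>Quarter periods\<close>

text \<open>With \<open>e\<close> the gap to the critical squared velocity, \<open>a < 1\<close>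
  gives \<open>xi_rate a b x \<le> e + 2 * x\<^sup>2\<close>, so the integrand is at least
  \<open>1 / (sqrt e + 2 * x)\<close>. Its integral diverges logarithmically as \<open>e\<close>
  tends to 0.\<close>

lemma xi_quarter_ge:
  assumes a: "0 < a" "a < 1" and b: "b\<^sup>2 < 2 / a - 2 * a"
  shows "xi_quarter a b \<ge> - ln (2 / a - 2 * a - b\<^sup>2) / 4"
proof -
  define e where "e = 2 / a - 2 * a - b\<^sup>2"
  define d where "d = sqrt e"
  have e: "e > 0" using b by (simp add: e_def)
  have d: "d > 0" "d\<^sup>2 = e" using e by (simp_all add: d_def)
  have I: "((\<lambda>x. 1 / (d + 2 * x)) has_integral ln (d + 2 * (pi / 2)) / 2 - ln (d + 2 * 0) / 2) {0..pi / 2}"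
  proof (rule fundamental_theorem_of_calculus)
    fix x :: real assume "x \<in> {0..pi / 2}"
    then show "((\<lambda>x. ln (d + 2 * x) / 2) has_vector_derivative 1 / (d + 2 * x)) (at x within {0..pi / 2})"
      using d unfolding has_real_derivative_iff_has_vector_derivative[symmetric]
      by (auto intro!: derivative_eq_intros simp: divide_simps)
  qed simp
  have "continuous_on {0..pi / 2} (\<lambda>x. 1 / sqrt (xi_rate a b x))"
    using xi_rate_pos[OF a(1) b] unfolding xi_rate_def by (intro continuous_intros) (auto simp: less_imp_neq[symmetric])
  then have J: "((\<lambda>x. 1 / sqrt (xi_rate a b x)) has_integral xi_quarter a b) {0..pi / 2}"
    unfolding xi_quarter_def by (intro integrable_integral integrable_continuous_real)
  have "ln (d + 2 * (pi / 2)) / 2 - ln (d + 2 * 0) / 2 \<le> xi_quarter a b"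
  proof (rule has_integral_le[OF I J])
    fix x :: real assume x: "x \<in> {0..pi / 2}"
    have "(sin x)\<^sup>2 \<le> x\<^sup>2" using abs_sin_x_le_abs_x[of x] by (simp add: abs_le_square_iff)
    then have "2 * a * (sin x)\<^sup>2 \<le> 2 * x\<^sup>2" using a mult_mono[of "2 * a" 2 "(sin x)\<^sup>2" "x\<^sup>2"] by simp
    then have "xi_rate a b x \<le> d\<^sup>2 + 2 * x\<^sup>2" unfolding xi_rate_def d e_def by simp
    also have "\<dots> \<le> (d + 2 * x)\<^sup>2" using d x by (simp add: power2_sum power_mult_distrib)
    finally have "sqrt (xi_rate a b x) \<le> d + 2 * x" using d x by (intro real_le_lsqrt) auto
    then show "1 / (d + 2 * x) \<le> 1 / sqrt (xi_rate a b x)"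
      using xi_rate_pos[OF a(1) b, of x] d x by (intro divide_left_mono mult_pos_pos) auto
  qed
  moreover have "ln (d + 2 * (pi / 2)) \<ge> 0" using d pi_gt3 by (intro ln_ge_zero) auto
  moreover have "ln d = ln e / 2" using e by (simp add: d_def ln_sqrt)
  ultimately show ?thesis by (simp add: e_def)
qed

lemma eta_quarter_le:
  assumes a: "0 < a" and b: "b\<^sup>2 < 2 / a - 2 * a"
  shows "eta_quarter a b \<le> pi / (4 * sqrt a)"
proof -
  have pos: "eta_rate a b x > 0" for x using eta_rate_ge[OF a b, of x] a by linarith
  have "continuous_on {0..pi / 2} (\<lambda>x. 1 / sqrt (eta_rate a b x))"
    using pos unfolding eta_rate_def by (intro continuous_intros) (auto simp: less_imp_neq[symmetric])
  then have J: "((\<lambda>x. 1 / sqrt (eta_rate a b x)) has_integral eta_quarter a b) {0..pi / 2}"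
    unfolding eta_quarter_def by (intro integrable_integral integrable_continuous_real)
  have K: "((\<lambda>x. 1 / sqrt (4 * a)) has_integral 1 / sqrt (4 * a) * (pi / 2)) {0..pi / 2}"
    using has_integral_const_real[of "1 / sqrt (4 * a)" 0 "pi / 2"] by (simp add: mult.commute)
  have "eta_quarter a b \<le> 1 / sqrt (4 * a) * (pi / 2)"
  proof (rule has_integral_le[OF J K])
    fix x :: real
    show "1 / sqrt (eta_rate a b x) \<le> 1 / sqrt (4 * a)"
      using eta_rate_ge[OF a b, of x] pos[of x] a by (intro divide_left_mono real_sqrt_le_mono mult_pos_pos) auto
  qed
  then show ?thesis by (simp add: real_sqrt_mult)
qed

text \<open>The exponential threshold is where the logarithmic lower bound for one quarter period
  meets \<open>c\<close> times the upper bound for the other. It serves both limits: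
  \<open>b\<close> tending to the critical velocity, and \<open>a\<close> tending to 1.\<close>

lemma quarter_ratio_gt:
  assumes a: "0 < a" "a < 1" and b: "b\<^sup>2 < 2 / a - 2 * a" and c: "c \<ge> 0"
    and e: "2 / a - 2 * a - b\<^sup>2 < exp (- c * pi / sqrt a)"
  shows "c * eta_quarter a b < xi_quarter a b"
proof -
  have "ln (2 / a - 2 * a - b\<^sup>2) < - c * pi / sqrt a"
    using e b by (metis diff_gt_0_iff_gt ln_exp ln_less_cancel_iff exp_gt_zero)
  then have "c * (pi / (4 * sqrt a)) < - ln (2 / a - 2 * a - b\<^sup>2) / 4" by simp
  moreover have "c * eta_quarter a b \<le> c * (pi / (4 * sqrt a))"
    using eta_quarter_le[OF a(1) b] c by (rule mult_left_mono)
  ultimately show ?thesis using xi_quarter_ge[OF a b] by linarith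
qed

lemma xi_quarter_continuous:
  assumes a: "0 < a" and U: "\<And>b. b \<in> U \<Longrightarrow> b\<^sup>2 < 2 / a - 2 * a"
  shows "continuous_on U (xi_quarter a)"
proof -
  have "xi_rate a b x \<noteq> 0" if "b \<in> U" for b x using xi_rate_pos[OF a U[OF that], of x] by simp
  then have "continuous_on (U \<times> cbox 0 (pi / 2)) (\<lambda>(b, x). 1 / sqrt (xi_rate a b x))"
    unfolding xi_rate_def split_beta by (intro continuous_intros) auto
  from integral_continuous_on_param[OF this] show ?thesis by (simp add: xi_quarter_def[abs_def])
qed

lemma eta_quarter_continuous:
  assumes a: "0 < a" and U: "\<And>b. b \<in> U \<Longrightarrow> b\<^sup>2 < 2 / a - 2 * a"
  shows "continuous_on U (eta_quarter a)"
proof -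
  have "eta_rate a b x \<noteq> 0" if "b \<in> U" for b x using eta_rate_ge[OF a U[OF that], of x] a by simp
  then have "continuous_on (U \<times> cbox 0 (pi / 2)) (\<lambda>(b, x). 1 / sqrt (eta_rate a b x))"
    using a unfolding eta_rate_def eta_amp2_def stark_energy_def split_beta by (intro continuous_intros) auto
  from integral_continuous_on_param[OF this] show ?thesis by (simp add: eta_quarter_def[abs_def])
qed

section \<open>Choice of the velocities for fixed \<open>a\<close>\<close>

text \<open>\<open>l c\<close> is the last point where \<open>R\<close> takes the value
  \<open>c\<close>. Last points at higher levels lie further right, which replaces monotonicity of
  \<open>R\<close>.\<close>

lemma last_level_points:
  fixes R :: "real \<Rightarrow> real"
  assumes "b0 < bc" and cont: "continuous_on {b0..<bc} R"
    and lim: "\<And>c. \<exists>b1<bc. \<forall>b. b1 < b \<and> b < bc \<longrightarrow> c < R b"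
  obtains l where "\<And>c. R b0 \<le> c \<Longrightarrow> b0 \<le> l c \<and> l c < bc \<and> R (l c) = c"
    "\<And>c b. R b0 \<le> c \<Longrightarrow> l c < b \<Longrightarrow> b < bc \<Longrightarrow> c < R b"
proof -
  have "\<exists>l. b0 \<le> l \<and> l < bc \<and> R l = c \<and> (\<forall>b. l < b \<and> b < bc \<longrightarrow> c < R b)" if c: "R b0 \<le> c" for c
  proof -
    obtain b' where b': "b' < bc" "\<And>b. b' < b \<Longrightarrow> b < bc \<Longrightarrow> c < R b" using lim by blast
    define b1 where "b1 = max b0 b'"
    have b1: "b0 \<le> b1" "b1 < bc" "\<And>b. b1 < b \<Longrightarrow> b < bc \<Longrightarrow> c < R b"
      using b' \<open>b0 < bc\<close> by (auto simp: b1_def)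
    \<comment> \<open>Beyond \<open>b1\<close> the values exceed \<open>c\<close>, so the maximum of
      this compact sublevel set is the last point with \<open>R b \<le> c\<close>.\<close>
    define Z where "Z = {b0..b1} \<inter> R -` {..c}"
    have "closed Z" unfolding Z_def
      by (rule continuous_closed_preimage) (use b1 in \<open>auto intro: continuous_on_subset[OF cont]\<close>)
    then have "compact Z" unfolding Z_def by (metis bounded_Int bounded_closed_interval compact_eq_bounded_closed)
    moreover have "b0 \<in> Z" using c b1 by (simp add: Z_def)
    ultimately obtain m where m: "m \<in> Z" "\<And>b. b \<in> Z \<Longrightarrow> b \<le> m"
      using compact_attains_sup[of Z] by blast
    have mb: "b0 \<le> m" "m \<le> b1" "R m \<le> c" using m by (auto simp: Z_def)
    \<comment> \<open>A point past \<open>b1\<close>, where \<open>R\<close> exceeds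
      \<open>c\<close>: the intermediate value theorem finds level \<open>c\<close> between
      \<open>m\<close> and \<open>b2\<close>, and maximality of \<open>m\<close> shows that it is
      attained at \<open>m\<close>.\<close>
    define b2 where "b2 = (b1 + bc) / 2"
    have b2: "b1 < b2" "b2 < bc" using b1 by (auto simp: b2_def)
    have "continuous_on {m..b2} R" using mb b2 by (intro continuous_on_subset[OF cont]) auto
    then obtain b where b: "m \<le> b" "b \<le> b2" "R b = c"
      using IVT'[of R m c b2] mb b2 b1(3)[OF b2] by auto
    have "b \<le> b1" using b1(3)[of b] b b2 by force
    then have "b \<in> Z" using b mb by (simp add: Z_def)
    then have "R m = c" using m b by force
    moreover have "c < R b" if "m < b" "b < bc" for b
    proof (cases "b \<le> b1")
      case True
      have "b \<notin> Z" using m(2) that by force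
      then show ?thesis using True mb that by (auto simp: Z_def)
    qed (use b1 that in auto)
    ultimately show ?thesis using mb b1 by (intro exI[of _ m]) auto
  qed
  then show thesis using that by metis
qed

lemma admissible_kp_exists:
  assumes a: "0 < a" "a < 1"
  shows "\<exists>kp. admissible_kp a kp"
proof -
  define bc where "bc = sqrt (2 / a - 2 * a)"
  have "a < 1 / a" using a mult_strict_mono[of a 1 a 1] by (simp add: less_divide_eq)
  then have bc2: "bc > 0" "bc\<^sup>2 = 2 / a - 2 * a" using a by (simp_all add: bc_def)
  \<comment> \<open>A start strictly between 0 and \<open>bc\<close> keeps all chosen velocities
    nonzero.\<close>
  define b0 where "b0 = bc / 2"
  have b0: "0 < b0" "b0 < bc" using bc2 by (auto simp: b0_def)
  have sub: "b\<^sup>2 < 2 / a - 2 * a" if "b \<in> {b0..<bc}" for b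
    using that b0 unfolding bc2(2)[symmetric] by (intro power_strict_mono) auto
  define R where "R b = xi_quarter a b / eta_quarter a b" for b
  have orbit: "\<exists>\<xi> \<eta> \<xi>' \<eta>' \<tau>. parabolic_orbit a b \<xi> \<eta> \<xi>' \<eta>' \<tau>" if "b \<in> {b0..<bc}" for b
    using parabolic_orbit_exists[OF a(1) sub[OF that]] by metis
  have pos: "eta_quarter a b > 0" if "b \<in> {b0..<bc}" for b
    using orbit[OF that] parabolic_orbit.L_pos(2) by blast
  have contR: "continuous_on {b0..<bc} R"
    unfolding R_def using pos
    by (intro continuous_intros xi_quarter_continuous eta_quarter_continuous a sub)
      (auto simp: less_imp_neq[symmetric])
  have limR: "\<exists>b1<bc. \<forall>b. b1 < b \<and> b < bc \<longrightarrow> c < R b" for c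
  proof -
    \<comment> \<open>The ratio estimate asks for a nonnegative factor.\<close>
    define m where "m = max c 0"
    have "((\<lambda>b. 2 / a - 2 * a - b\<^sup>2) \<longlongrightarrow> 2 / a - 2 * a - bc\<^sup>2) (at_left bc)"
      by (intro tendsto_intros)
    moreover have "2 / a - 2 * a - bc\<^sup>2 < exp (- m * pi / sqrt a)" unfolding bc2 by simp
    ultimately have "eventually (\<lambda>b. 2 / a - 2 * a - b\<^sup>2 < exp (- m * pi / sqrt a)) (at_left bc)"
      by (rule order_tendstoD)
    then obtain b1 where b1: "b1 < bc" "\<And>b. b1 < b \<Longrightarrow> b < bc \<Longrightarrow> 2 / a - 2 * a - b\<^sup>2 < exp (- m * pi / sqrt a)"
      unfolding eventually_at_left[OF b0(2)] by blast
    have "c < R b" if b: "max b1 b0 < b" "b < bc" for b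
    proof -
      have b': "b \<in> {b0..<bc}" using b by auto
      have "m * eta_quarter a b < xi_quarter a b"
        by (rule quarter_ratio_gt[OF a sub[OF b'] _ b1(2)]) (use b in \<open>auto simp: m_def\<close>)
      then have "m < R b" using pos[OF b'] by (simp add: R_def less_divide_eq)
      then show ?thesis by (simp add: m_def)
    qed
    then show ?thesis using b0 b1 by (intro exI[of _ "max b1 b0"]) auto
  qed
  obtain l where l: "\<And>c. R b0 \<le> c \<Longrightarrow> b0 \<le> l c \<and> l c < bc \<and> R (l c) = c"
    and l_last: "\<And>c b. R b0 \<le> c \<Longrightarrow> l c < b \<Longrightarrow> b < bc \<Longrightarrow> c < R b"
    using last_level_points[OF b0(2) contR limR] by blast
  \<comment> \<open>Past \<open>l c'\<close> the values exceed \<open>c'\<close>, so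
    \<open>l c\<close>, where the value is only \<open>c\<close>, lies before it.\<close>
  have l_mono: "l c < l c'" if "R b0 \<le> c" "c < c'" for c c'
    using l[of c] l[of c'] l_last[of c' "l c"] that by (cases "l c = l c'") force+
  have l_ge: "b \<le> l c" if "R b0 \<le> c" "R b \<le> c" "b < bc" for b c
    using l_last[of c b] that by force
  have l_lim: "(\<lambda>k::nat. l (2 * real k + j)) \<longlonglongrightarrow> bc" if "j \<ge> 0" for j
  proof (rule order_tendstoI)
    have ev: "eventually (\<lambda>k::nat. c \<le> 2 * real k + j) sequentially" for c
    proof -
      obtain n :: nat where "c \<le> real n" using real_arch_simple by blast
      then show ?thesis using \<open>j \<ge> 0\<close> unfolding eventually_sequentially by (intro exI[of _ n]) auto
    qed
    fix m assume m: "m < bc"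
    define b where "b = (m + bc) / 2"
    have b: "m < b" "b < bc" using m by (auto simp: b_def)
    show "eventually (\<lambda>k. m < l (2 * real k + j)) sequentially"
      using ev[of "R b0"] ev[of "R b"] by eventually_elim (use l_ge[OF _ _ b(2)] b in force)
  next
    fix m assume m: "bc < m"
    obtain n :: nat where n: "R b0 \<le> real n" using real_arch_simple by blast
    show "eventually (\<lambda>k. l (2 * real k + j) < m) sequentially"
      unfolding eventually_sequentially
    proof (intro exI allI impI)
      fix k assume "n \<le> k"
      then show "l (2 * real k + j) < m" using l[of "2 * real k + j"] n m \<open>j \<ge> 0\<close> by force
    qed
  qed
  \<comment> \<open>From this index on, every level \<open>2 * k + 1\<close> and
    \<open>2 * k + 2\<close> is at least \<open>R b0\<close> and hence attained; minimality is not
    claimed.\<close>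
  obtain kp :: nat where kp: "R b0 \<le> real kp" using real_arch_simple by blast
  have ge: "R b0 \<le> 2 * real k + 1" if "k \<ge> kp" for k
    using kp that by linarith
  have quarter: "l c \<noteq> 0 \<and> xi_quarter a (l c) = c * eta_quarter a (l c) \<and> l c \<in> {b0..<bc}" if "R b0 \<le> c" for c
    using l[OF that] b0 pos[of "l c"] by (auto simp: R_def field_simps)
  have "periodic_A a (l (2 * real k + 1)) k" if "k \<ge> kp" for k
  proof -
    note q = quarter[OF ge[OF that]]
    from q obtain \<xi> \<eta> \<xi>' \<eta>' \<tau> where "parabolic_orbit a (l (2 * real k + 1)) \<xi> \<eta> \<xi>' \<eta>' \<tau>"
      using orbit by blast
    from parabolic_orbit.periodic[OF this] q show ?thesis by blast
  qed
  moreover have "collision_B a (l (2 * real k + 2)) k" if "k \<ge> kp" for k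
  proof -
    have "R b0 \<le> 2 * real k + 2" using ge[OF that] by simp
    note q = quarter[OF this]
    from q obtain \<xi> \<eta> \<xi>' \<eta>' \<tau> where "parabolic_orbit a (l (2 * real k + 2)) \<xi> \<eta> \<xi>' \<eta>' \<tau>"
      using orbit by blast
    from parabolic_orbit.collision[OF this, of k] q show ?thesis by (simp add: algebra_simps)
  qed
  moreover have "l (2 * real k + 1) < l (2 * real k + 2) \<and> l (2 * real k + 2) < l (2 * real (Suc k) + 1)"
    if "k \<ge> kp" for k
    using ge[OF that] by (auto intro!: l_mono)
  ultimately have "admissible_kp a kp"
    unfolding admissible_kp_def bc_def[symmetric] using l_lim[of 1] l_lim[of 2]
    by (intro exI[of _ "\<lambda>k. l (2 * real k + 1)"] exI[of _ "\<lambda>k. l (2 * real k + 2)"]) auto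
  then show ?thesis ..
qed

section \<open>Growth of the crossing number as \<open>a\<close> tends to 1\<close>

text \<open>The bound is uniform in \<open>b\<close>. Below the critical velocity the gap is at most
  \<open>2 / a - 2 * a\<close>, and \<open>a > 1 / 4\<close> gives
  \<open>sqrt a \<ge> 1 / 2\<close>, which turns the threshold into
  \<open>exp (- 4 * n * pi)\<close>. From the critical velocity on, \<open>stark_barrier\<close>
  forbids reaching the negative axis.\<close>

lemma periodic_A_crossings_ge:
  assumes a: "1 / 4 < a" "a < 1" and small: "2 / a - 2 * a < exp (- 4 * real n * pi)"
    and A: "periodic_A a b k"
  shows "n \<le> k"
proof (cases "b\<^sup>2 < 2 / a - 2 * a")
  case True
  have a0: "0 < a" using a by simp
  obtain \<xi> \<eta> \<xi>' \<eta>' \<tau> where P: "parabolic_orbit a b \<xi> \<eta> \<xi>' \<eta>' \<tau>"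
    using parabolic_orbit_exists[OF a0 True] by blast
  have "sqrt (1 / 4) \<le> sqrt a" using a by (intro real_sqrt_le_mono) simp
  then have "1 / 2 \<le> sqrt a" by (simp add: real_sqrt_divide)
  then have "2 * real n * pi / sqrt a \<le> 2 * real n * pi / (1 / 2)"
    using a0 by (intro divide_left_mono) auto
  then have "- 4 * real n * pi \<le> - (2 * real n) * pi / sqrt a" by simp
  then have "exp (- 4 * real n * pi) \<le> exp (- (2 * real n) * pi / sqrt a)" by (rule exp_le_cancel_iff[THEN iffD2])
  then have "2 / a - 2 * a - b\<^sup>2 < exp (- (2 * real n) * pi / sqrt a)"
    using small zero_le_power2[of b] by linarith
  from quarter_ratio_gt[OF a0 a(2) True _ this]
  show ?thesis by (intro parabolic_orbit.crossings_lower_bound[OF P A]) simp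
next
  case False
  obtain x y u v T where sol: "stark_sol x y u v {0..}" "stark_init x y u v a b"
    and T: "T > 0" "y T = 0" "x T < 0"
    using A unfolding periodic_A_def by blast
  have "x T \<ge> 0" by (rule stark_barrier[OF sol]) (use a False T in auto)
  then show ?thesis using T by simp
qed

theorem theorem1p3:
  shows "(\<forall>a::real. 0 < a \<and> a < 1 \<longrightarrow> (\<exists>kp. admissible_kp a kp)) \<and>
         filterlim (\<lambda>a::real. LEAST kp. admissible_kp a kp) at_top (at_left 1)"
proof (intro conjI allI impI)
  show "\<exists>kp. admissible_kp a kp" if "0 < a \<and> a < 1" for a :: real
    using that admissible_kp_exists by blast
  show "filterlim (\<lambda>a::real. LEAST kp. admissible_kp a kp) at_top (at_left 1)"
    unfolding filterlim_at_top
  proof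
    fix n :: nat
    have "((\<lambda>a::real. 2 / a - 2 * a) \<longlongrightarrow> 2 / 1 - 2 * 1) (at_left 1)"
      by (intro tendsto_intros) auto
    then have "eventually (\<lambda>a::real. 2 / a - 2 * a < exp (- 4 * real n * pi)) (at_left 1)"
      by (rule order_tendstoD) simp
    moreover have "eventually (\<lambda>a::real. a \<in> {1 / 4<..<1}) (at_left 1)"
      by (rule eventually_at_left_real) simp
    ultimately show "eventually (\<lambda>a::real. n \<le> (LEAST kp. admissible_kp a kp)) (at_left 1)"
    proof eventually_elim
      case (elim a)
      \<comment> \<open>Admissibility at the index \<open>k = kp\<close> itself provides a periodic
        orbit with exactly \<open>kp\<close> crossings, so the crossing bound applies to the least
        \<open>kp\<close>.\<close>
      then have "admissible_kp a (LEAST kp. admissible_kp a kp)"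
        using LeastI_ex[OF admissible_kp_exists[of a]] by simp
      then obtain b where "periodic_A a b (LEAST kp. admissible_kp a kp)"
        unfolding admissible_kp_def by blast
      then show ?case using elim periodic_A_crossings_ge[of a n b] by simp
    qed
  qed
qed

end
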